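(* Let $L,\eta\in\mathbb{C}$ with $L\notin-(\mathbb{N}+1)/2=\{-1,-\tfrac32,-2,-\tfrac52,\dots\}$, and let $n\in\mathbb{N}$. Let $H_n(L,\eta)$ be the $n\times n$ Hankel matrix whose $(i,j)$-th entry, $1\le i,j\le n$, is $\zeta_L(i+j)$. Then $$\det H_{n}(L,\eta)=\prod_{k=0}^{n-1}\frac{1}{(2L+2n-2k+1)^{2k+1}}\left(1+\frac{\eta^{2}}{(L+n-k)^{2}}\right)^{k+1}.$$
   Context: $\mathbb{N}$ denotes the set of positive integers and $\mathbb{N}_0=\{0\}\cup\mathbb{N}$. For $L\notin-(\mathbb{N}+1)/2$ and $\eta\in\mathbb{C}$, define the entire function of $\rho\in\mathbb{C}$ $$\phi_{L}(\eta,\rho):=e^{-\mathrm{i}\rho}\,{}_{1}F_{1}(L+1-\mathrm{i}\eta;2L+2;2\mathrm{i}\rho),$$ where ${}_{1}F_{1}(a;b;z)=\sum_{m=0}^{\infty}\frac{(a)_{m}}{(b)_{m}}\frac{z^{m}}{m!}$ for $b\notin-\mathbb{N}_0$, with Pochhammer symbol $(a)_0=1$ and $(a)_m=a(a+1)\cdots(a+m-1)$ for $m\in\mathbb{N}$. (This is, up to an elementary factor, the regular Coulomb wave function.) Let $\rho_{L,1},\rho_{L,2},\dots$ be the zeros of $\phi_L(\eta,\cdot)$, counted with multiplicity (they depend on $\eta$ as well; all are nonzero since $\phi_L(\eta,0)=1$). For integers $k\ge 2$ the spectral zeta function is the absolutely convergent sum over all zeros $$\zeta_{L}(k):=\sum_{m\ge1}\frac{1}{\rho_{L,m}^{k}},$$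 where the dependence on $\eta$ is suppressed in the notation. *)

theory Defs
  imports "HOL-Complex_Analysis.Complex_Analysis" "Jordan_Normal_Form.Determinant"
begin

definition kummer_1F1 :: "complex \<Rightarrow> complex \<Rightarrow> complex \<Rightarrow> complex" where
  "kummer_1F1 a b z = (\<Sum>m. pochhammer a m / pochhammer b m * (z ^ m / fact m))"

definition coulomb_phi :: "complex \<Rightarrow> complex \<Rightarrow> complex \<Rightarrow> complex" where
  "coulomb_phi L \<eta> \<rho> =
     exp (- \<i> * \<rho>) * kummer_1F1 (L + 1 - \<i> * \<eta>) (2 * L + 2) (2 * \<i> * \<rho>)"

text \<open>
  The sum runs over the set of distinct zeros; multiplicity enters as the weight
  \<^const>\<open>zorder\<close>, which is the order of the zero because \<open>coulomb_phi L \<eta>\<close> is entire and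
  takes the value 1 at 0 (for admissible \<open>L\<close>).
  For complex-valued families \<^const>\<open>infsum\<close> is absolutely convergent summation.
\<close>

definition coulomb_zeta :: "complex \<Rightarrow> complex \<Rightarrow> nat \<Rightarrow> complex" where
  "coulomb_zeta L \<eta> k =
     (\<Sum>\<^sub>\<infinity>\<rho> \<in> {\<rho>. coulomb_phi L \<eta> \<rho> = 0}. of_int (zorder (coulomb_phi L \<eta>) \<rho>) * (1 / \<rho> ^ k))"

text \<open>
  Matrices of \<^typ>\<open>complex mat\<close> are indexed from 0, so the entry in 1-based position
  \<open>(i + 1, j + 1)\<close> is the zeta value at \<open>i + j + 2\<close>.
\<close>

definition coulomb_hankel :: "nat \<Rightarrow> complex \<Rightarrow> complex \<Rightarrow> complex mat" where
  "coulomb_hankel n L \<eta> = Matrix.mat n n (\<lambda>(i, j). coulomb_zeta L \<eta> ((i + 1) + (j + 1)))"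

end

theory Submission
  imports Defs
begin

text \<open>
  The function \<phi>_L is entire of exponential type with value 1 at 0. For such a function
  the zeta values of the zeros are, from exponent 2 on, up to sign the Taylor coefficients of the
  logarithmic derivative. Since \<phi>_L' is a linear combination of \<phi>_L and z \<phi>_{L+1}, the Hankel
  matrix is therefore c_L times the one of the Taylor coefficients of \<phi>_{L+1} / \<phi>_L, where
  c_L = (1 + \<eta>^2 / (L+1)^2) / (2 L + 3). The three-term recurrence between
  \<phi>_L, \<phi>_{L+1}, \<phi>_{L+2} is one step of a J-fraction for this quotient, and one such step reduces the
  (n+1) x (n+1) Hankel determinant for L to the n x n one for L + 1.
\<close>

subsection \<open>Zeros of entire functions of exponential type\<close>

text \<open>Two points shape the development. Exponent 1 is excluded because the sum of reciprocals
  of the zeros need not converge absolutely; in the logarithmic derivative this ambiguity only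
  touches the coefficient of index 0. No canonical product is formed: the zeros of a finite disc are
  divided out, and the error in each fixed coefficient of higher index is shown to vanish as the
  radius grows. Secondly, c_L vanishes when \<eta> = \<plusminus> i (L + 1), so leading minors may
  be zero. The reduction step is therefore a matrix identity that never divides by a coefficient of
  the J-fraction. The exponents in the product arise because that coefficient is c_{L+1} / (2 L +
  3), and c_{L+1} is also the scalar in front of the Hankel matrix for L + 1. It is absorbed there,
  which leaves det H_{n+1}(L) = c_L^(n+1) / (2 L + 3)^n * det H_n(L + 1).\<close>

lemma borel_caratheodory_norm_le:
  fixes h :: "complex \<Rightarrow> complex"
  assumes holo: "h holomorphic_on ball 0 R" and "R > 0" and "h 0 = 0"
    and Re_less: "\<And>z. norm z < R \<Longrightarrow> Re (h z) < A"
    and z: "norm z \<le> R / 2"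
  shows "norm (h z) \<le> 2 * A"
proof -
  have "A > 0"
    using Re_less[of 0] assms by simp
  \<comment> \<open>The Moebius map v / (2 A - v) sends the half plane Re v < A into the unit disc
    and fixes 0, so Schwarz's lemma applies to the rescaled \<open>h\<close>. Where |w| \<le> 1/2,
    solving back gives |h| = 2 A |w| / |1 + w| \<le> 2 A.\<close>
  define w where "w = (\<lambda>u. h (of_real R * u) / (2 * of_real A - h (of_real R * u)))"
  have in_ball: "norm (of_real R * u) < R" if "norm u < 1" for u :: complex
    using that \<open>R > 0\<close> by (simp add: norm_mult)
  have ne: "2 * of_real A - h (of_real R * u) \<noteq> 0" if "norm u < 1" for u :: complex
  proof
    assume "2 * of_real A - h (of_real R * u) = 0"
    hence "Re (h (of_real R * u)) = Re (2 * of_real A)"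
      by (metis eq_iff_diff_eq_0)
    thus False
      using Re_less[OF in_ball[OF that]] \<open>A > 0\<close> by simp
  qed
  have lt1: "norm (w u) < 1" if "norm u < 1" for u
  proof -
    define v where "v = h (of_real R * u)"
    have "Re v < A"
      using Re_less[OF in_ball[OF that]] by (simp add: v_def)
    hence "A * Re v < A * A"
      using \<open>A > 0\<close> by simp
    hence "(Re v)\<^sup>2 + (Im v)\<^sup>2 < (2 * A - Re v)\<^sup>2 + (Im v)\<^sup>2"
      by (simp add: power2_eq_square algebra_simps)
    hence "norm v < norm (2 * of_real A - v)"
      unfolding cmod_def by simp
    thus ?thesis
      using ne[OF that] unfolding w_def v_def[symmetric]
      by (simp add: norm_divide)
  qed
  have holo_w: "w holomorphic_on ball 0 1"
    unfolding w_def
    by (intro holomorphic_intros holomorphic_on_compose_gen[OF _ holo, unfolded o_def])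
       (use in_ball ne in auto)
  define u where "u = z / of_real R"
  have u: "norm u \<le> 1 / 2"
    using z \<open>R > 0\<close> by (simp add: u_def norm_divide field_simps)
  have "norm (w u) \<le> norm u"
    by (rule Schwarz_Lemma(1)[OF holo_w]) (use u lt1 \<open>h 0 = 0\<close> in \<open>auto simp: w_def\<close>)
  hence w_le: "norm (w u) \<le> 1 / 2"
    using u by simp
  have Ru: "of_real R * u = z"
    using \<open>R > 0\<close> by (simp add: u_def)
  have h_eq: "h z * (1 + w u) = 2 * of_real A * w u"
    using ne[of u] u unfolding w_def Ru by (simp add: field_simps)
  have "norm (h z) * (1 / 2) \<le> norm (h z) * norm (1 + w u)"
    using w_le norm_triangle_ineq4[of "1 + w u" "w u"] by (intro mult_left_mono) auto
  also have "\<dots> = 2 * A * norm (w u)"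
    using \<open>A > 0\<close> by (simp flip: norm_mult add: h_eq) (simp add: norm_mult)
  also have "\<dots> \<le> 2 * A * (1 / 2)"
    using w_le \<open>A > 0\<close> by (intro mult_left_mono) auto
  finally show ?thesis by simp
qed

text \<open>Induction on \<open>S\<close>: at each new point the current quotient is divided by its
  full order there. The value at \<open>z0\<close> rules out the zero function, for which no such
  order exists. A point of \<open>S\<close> that is not a zero gets exponent 0.\<close>

lemma holomorphic_factor_zeros:
  fixes f :: "complex \<Rightarrow> complex"
  assumes holo: "f holomorphic_on UNIV" and nz: "f z0 \<noteq> 0"
    and S: "finite S" "0 \<notin> S"
  obtains F where "F holomorphic_on UNIV"
    "\<And>z. f z = (\<Prod>\<rho>\<in>S. (1 - z / \<rho>) ^ nat (zorder f \<rho>)) * F z"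
    "\<And>\<rho>. \<rho> \<in> S \<Longrightarrow> F \<rho> \<noteq> 0"
proof -
  have "\<exists>F n. F holomorphic_on UNIV \<and> (\<forall>z. f z = (\<Prod>\<rho>\<in>S. (1 - z / \<rho>) ^ n \<rho>) * F z) \<and>
          (\<forall>\<rho>\<in>S. F \<rho> \<noteq> 0)"
    using S
  proof (induction S)
    case empty
    thus ?case using holo by auto
  next
    case (insert r S)
    then obtain F n where F: "F holomorphic_on UNIV"
      and f_eq: "\<And>z. f z = (\<Prod>\<rho>\<in>S. (1 - z / \<rho>) ^ n \<rho>) * F z"
      and F_nz: "\<And>\<rho>. \<rho> \<in> S \<Longrightarrow> F \<rho> \<noteq> 0"
      by auto
    have [simp]: "r \<noteq> 0"
      using insert.prems by auto
    define g where "g = zor_poly F r"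
    define k where "k = nat (zorder F r)"
    have "F z0 \<noteq> 0"
      using nz f_eq by auto
    hence "\<exists>w\<in>UNIV. F w \<noteq> 0" by blast
    from zorder_exist_zero[OF F open_UNIV connected_UNIV UNIV_I this, of r]
    obtain d where d: "d > 0" "g holomorphic_on cball r d"
        "\<And>w. w \<in> cball r d \<Longrightarrow> F w = g w * (w - r) ^ k \<and> g w \<noteq> 0"
      unfolding g_def k_def by meson
    \<comment> \<open>The removable singularity at \<open>r\<close> is filled with the value of
      \<open>g\<close>; the constant \<open>(-r) ^ k\<close> turns the factor w - r into the
      normalised factor 1 - w / r.\<close>
    define G where "G = (\<lambda>w. (-r) ^ k * (if w = r then g r else F w / (w - r) ^ k))"
    have G_eq_g: "G w = (-r) ^ k * g w" if "w \<in> cball r d" for w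
      using d(3)[OF that] by (auto simp: G_def)
    have F_eq: "F w = (1 - w / r) ^ k * G w" for w
    proof (cases "w = r")
      case True
      thus ?thesis using d(1) d(3)[of r] by (cases "k = 0") (auto simp: G_def)
    next
      case False
      have "w - r = (1 - w / r) * (-r)"
        by (simp add: field_simps)
      hence "(w - r) ^ k = (1 - w / r) ^ k * (-r) ^ k"
        by (metis power_mult_distrib)
      thus ?thesis using False by (simp add: G_def field_simps)
    qed
    have "G holomorphic_on (-{r} \<union> ball r d)"
    proof (rule holomorphic_on_Un)
      have "(\<lambda>w. (-r) ^ k * (F w / (w - r) ^ k)) holomorphic_on -{r}"
        by (intro holomorphic_intros holomorphic_on_subset[OF F]) auto
      thus "G holomorphic_on -{r}"
        by (rule holomorphic_transform) (auto simp: G_def)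
      have "(\<lambda>w. (-r) ^ k * g w) holomorphic_on ball r d"
        by (intro holomorphic_intros holomorphic_on_subset[OF d(2)]) auto
      thus "G holomorphic_on ball r d"
        by (rule holomorphic_transform) (auto simp: G_eq_g)
    qed auto
    moreover have "-{r} \<union> ball r d = UNIV"
      using d(1) by auto
    ultimately have G: "G holomorphic_on UNIV"
      by simp
    define m where "m = n(r := k)"
    have "f z = (\<Prod>\<rho>\<in>insert r S. (1 - z / \<rho>) ^ m \<rho>) * G z" for z
    proof -
      have "(\<Prod>\<rho>\<in>S. (1 - z / \<rho>) ^ n \<rho>) = (\<Prod>\<rho>\<in>S. (1 - z / \<rho>) ^ m \<rho>)"
        using insert.hyps by (intro prod.cong) (auto simp: m_def)
      thus ?thesis
        using insert.hyps f_eq[of z] F_eq[of z] by (simp add: m_def)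
    qed
    moreover have "G \<rho> \<noteq> 0" if "\<rho> \<in> insert r S" for \<rho>
      using that F_nz[of \<rho>] F_eq[of \<rho>] G_eq_g[of r] d(1) d(3)[of r] by auto
    ultimately show ?case
      using G by blast
  qed
  \<comment> \<open>The induction only yields the order of an intermediate quotient as exponent.
    Since the other linear factors and \<open>F\<close> do not vanish at \<open>r\<close>, that
    exponent is the order of \<open>f\<close> itself.\<close>
  then obtain F n where F: "F holomorphic_on UNIV"
    and f_eq: "\<And>z. f z = (\<Prod>\<rho>\<in>S. (1 - z / \<rho>) ^ n \<rho>) * F z"
    and F_nz: "\<And>\<rho>. \<rho> \<in> S \<Longrightarrow> F \<rho> \<noteq> 0"
    by blast
  have "nat (zorder f r) = n r" if r: "r \<in> S" for r
  proof -
    have [simp]: "r \<noteq> 0"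
      using r S by auto
    define h where "h = (\<lambda>z. (\<Prod>\<rho>\<in>S - {r}. (1 - z / \<rho>) ^ n \<rho>) * F z / (-r) ^ n r)"
    have "zorder f r = int (n r)"
    proof (rule zorder_eqI[of UNIV _ h])
      show "h holomorphic_on UNIV"
        unfolding h_def by (intro holomorphic_intros F) (use S in auto)
      show "h r \<noteq> 0"
        using F_nz[OF r] S by (auto simp: h_def)
      fix w assume "w \<noteq> r"
      have "1 - w / r = (w - r) / (-r)"
        by (simp add: field_simps)
      hence "(1 - w / r) ^ n r = (w - r) ^ n r / (-r) ^ n r"
        by (simp only: power_divide)
      thus "f w = h w * (w - r) powi int (n r)"
        using S r by (simp add: f_eq h_def prod.remove[of S r])
    qed auto
    thus ?thesis by simp
  qed
  thus ?thesis
    using that[of F] F f_eq F_nz by simp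
qed

section \<open>Logarithmic derivatives of formal power series\<close>

lemma fps_prod_nth_0:
  fixes A :: "'b \<Rightarrow> 'a :: comm_ring_1 fps"
  shows "fps_nth (\<Prod>x\<in>S. A x) 0 = (\<Prod>x\<in>S. fps_nth (A x) 0)"
  by (induction S rule: infinite_finite_induct) auto

lemma fps_log_deriv_mult:
  fixes A B :: "'a :: field fps"
  assumes "fps_nth A 0 \<noteq> 0" "fps_nth B 0 \<noteq> 0"
  shows "fps_deriv (A * B) * inverse (A * B) = fps_deriv A * inverse A + fps_deriv B * inverse B"
proof -
  have "fps_deriv (A * B) * inverse (A * B) =
      (A * inverse A) * (fps_deriv B * inverse B) + (B * inverse B) * (fps_deriv A * inverse A)"
    by (simp add: fps_inverse_mult algebra_simps)
  thus ?thesis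
    using assms by (simp add: inverse_mult_eq_1' add.commute)
qed

lemma fps_log_deriv_power:
  fixes A :: "'a :: field fps"
  assumes "fps_nth A 0 \<noteq> 0"
  shows "fps_deriv (A ^ n) * inverse (A ^ n) = of_nat n * (fps_deriv A * inverse A)"
proof (induction n)
  case (Suc n)
  thus ?case
    using assms fps_log_deriv_mult[of A "A ^ n"] by (simp add: fps_power_zeroth algebra_simps)
qed auto

lemma fps_log_deriv_prod_power:
  fixes A :: "'b \<Rightarrow> 'a :: field fps"
  assumes "\<And>x. x \<in> S \<Longrightarrow> fps_nth (A x) 0 \<noteq> 0"
  shows "fps_deriv (\<Prod>x\<in>S. A x ^ n x) * inverse (\<Prod>x\<in>S. A x ^ n x) =
    (\<Sum>x\<in>S. of_nat (n x) * (fps_deriv (A x) * inverse (A x)))"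
  using assms
proof (induction S rule: infinite_finite_induct)
  case (insert x S)
  have "fps_nth (\<Prod>x\<in>S. A x ^ n x) 0 \<noteq> 0"
    using insert by (simp add: fps_prod_nth_0 fps_power_zeroth)
  thus ?case
    using insert fps_log_deriv_mult[of "A x ^ n x" "\<Prod>x\<in>S. A x ^ n x"]
    by (simp add: fps_power_zeroth fps_log_deriv_power)
qed auto

text \<open>Geometric series. With \<open>a = 1 / \<rho>\<close> the coefficient of index
  \<open>k\<close> is minus the summand of the zeta value at \<open>k + 1\<close>; this is the
  source of the sign and of the index shift.\<close>

lemma fps_log_deriv_linear:
  fixes a :: "'a :: field"
  shows "fps_deriv (1 - fps_const a * fps_X) * inverse (1 - fps_const a * fps_X) = Abs_fps (\<lambda>k. - (a ^ Suc k))"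
proof -
  have "(1 - fps_const a * fps_X) * Abs_fps (\<lambda>k. a ^ k) = 1"
  proof (rule fps_ext)
    fix n show "fps_nth ((1 - fps_const a * fps_X) * Abs_fps (\<lambda>k. a ^ k)) n = fps_nth 1 n"
      by (cases n) (simp_all add: algebra_simps)
  qed
  hence inv: "inverse (1 - fps_const a * fps_X) = Abs_fps (\<lambda>k. a ^ k)"
    by (simp add: fps_inverse_unique)
  have "fps_deriv (1 - fps_const a * fps_X) = fps_const (-a)"
    by (simp flip: fps_const_neg)
  thus ?thesis
    unfolding inv by (simp add: fps_eq_iff)
qed

section \<open>Zeros of functions of exponential type: counting, summability, power sums\<close>

locale exponential_type =
  fixes f :: "complex \<Rightarrow> complex" and c :: real
  assumes holo: "f holomorphic_on UNIV"
    and at_0: "f 0 = 1"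
    and growth: "norm (f z) \<le> exp (c * norm z)"
    and c_pos: "c > 0"
begin

abbreviation zeros_upto :: "real \<Rightarrow> complex set" where
  "zeros_upto R \<equiv> {\<rho>. f \<rho> = 0 \<and> norm \<rho> \<le> R}"

abbreviation ord :: "complex \<Rightarrow> nat" where
  "ord \<rho> \<equiv> nat (zorder f \<rho>)"

lemma finite_zeros: "finite (zeros_upto R)"
proof -
  have "\<not> f constant_on UNIV \<or> (\<forall>z. f z \<noteq> 0)"
    using at_0 unfolding constant_on_def by force
  thus ?thesis
  proof
    assume "\<not> f constant_on UNIV"
    hence "finite {z \<in> cball 0 R. f z = 0}"
      by (intro holomorphic_compact_finite_zeros[OF holo]) auto
    thus ?thesis by (rule finite_subset[rotated]) auto
  qed auto
qed

lemma zorder_eq_ord: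
  assumes "f \<rho> = 0"
  shows "zorder f \<rho> = int (ord \<rho>)" "ord \<rho> > 0"
proof -
  have "zorder f \<rho> > 0"
    using zorder_exist_zero[OF holo, of \<rho>] assms at_0 by (metis UNIV_I connected_UNIV open_UNIV zero_neq_one)
  thus "zorder f \<rho> = int (ord \<rho>)" "ord \<rho> > 0"
    by auto
qed

text \<open>A substitute for Jensen's formula by the maximum principle. The bound on
  \<open>F\<close> is used twice: at 0, where \<open>F 0 = 1\<close>, it limits the number of zeros,
  and inside the disc of radius \<open>R\<close> it bounds the real part of a logarithm of
  \<open>F\<close>.\<close>

lemma factor_zeros_upto:
  assumes R: "R > 0"
  obtains F where "F holomorphic_on UNIV"
    "\<And>z. f z = (\<Prod>\<rho>\<in>zeros_upto R. (1 - z / \<rho>) ^ ord \<rho>) * F z"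
    "\<And>z. norm z \<le> R \<Longrightarrow> F z \<noteq> 0"
    "\<And>z. norm z \<le> 4 * R \<Longrightarrow>
       3 ^ (\<Sum>\<rho>\<in>zeros_upto R. ord \<rho>) * norm (F z) \<le> exp (4 * c * R)"
proof -
  obtain F where F: "F holomorphic_on UNIV"
      and f_eq: "\<And>z. f z = (\<Prod>\<rho>\<in>zeros_upto R. (1 - z / \<rho>) ^ ord \<rho>) * F z"
      and F_nz: "\<And>\<rho>. \<rho> \<in> zeros_upto R \<Longrightarrow> F \<rho> \<noteq> 0"
  proof (rule holomorphic_factor_zeros[OF holo _ finite_zeros])
    show "f 0 \<noteq> 0" "0 \<notin> zeros_upto R"
      using at_0 by auto
  qed blast
  have nz: "F z \<noteq> 0" if "norm z \<le> R" for z
    using F_nz[of z] f_eq[of z] that by (cases "f z = 0") auto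
  define N where "N = (\<Sum>\<rho>\<in>zeros_upto R. ord \<rho>)"
  \<comment> \<open>On the circle of radius \<open>4 * R\<close> every linear factor has modulus at least 3.\<close>
  have bound: "norm (F z) \<le> exp (4 * c * R) / 3 ^ N" if z: "norm z \<le> 4 * R" for z
  proof (rule maximum_modulus_frontier[of F "cball 0 (4 * R)"])
    fix w :: complex assume "w \<in> frontier (cball 0 (4 * R))"
    hence w: "norm w = 4 * R"
      using R by (simp add: frontier_cball)
    have "3 ^ N = (\<Prod>\<rho>\<in>zeros_upto R. 3 ^ ord \<rho> :: real)"
      by (simp add: N_def power_sum)
    also have "\<dots> \<le> (\<Prod>\<rho>\<in>zeros_upto R. norm (1 - w / \<rho>) ^ ord \<rho>)"
    proof (intro prod_mono conjI power_mono)
      fix \<rho> assume \<rho>: "\<rho> \<in> zeros_upto R"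
      hence "\<rho> \<noteq> 0"
        using at_0 by auto
      hence "4 \<le> norm (w / \<rho>)"
        using \<rho> w R by (simp add: norm_divide field_simps)
      thus "3 \<le> norm (1 - w / \<rho>)"
        using norm_triangle_ineq2[of "w / \<rho>" 1] by (simp add: norm_minus_commute)
    qed auto
    also have "\<dots> = norm (\<Prod>\<rho>\<in>zeros_upto R. (1 - w / \<rho>) ^ ord \<rho>)"
      by (simp add: norm_power flip: prod_norm)
    finally have "3 ^ N * norm (F w) \<le> norm (\<Prod>\<rho>\<in>zeros_upto R. (1 - w / \<rho>) ^ ord \<rho>) * norm (F w)"
      by (rule mult_right_mono) simp
    also have "\<dots> = norm (f w)"
      by (subst f_eq) (rule norm_mult [symmetric])
    also have "\<dots> \<le> exp (4 * c * R)"
      using growth[of w] w by (simp add: mult_ac)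
    finally show "norm (F w) \<le> exp (4 * c * R) / 3 ^ N"
      by (simp add: field_simps)
  qed (use F z in \<open>auto intro: holomorphic_on_subset holomorphic_on_imp_continuous_on\<close>)
  show ?thesis
    by (rule that[OF F f_eq nz]) (use bound in \<open>auto simp: N_def field_simps\<close>)
qed

text \<open>At 0 the factor bound reads 3^N \<le> exp (4 c R), and e \<le> 3. As the growth
  condition carries no multiplicative constant, the count has no additive term, so for small
  \<open>R\<close> it even excludes zeros.\<close>

lemma zero_count_le:
  assumes R: "R > 0"
  shows "real (\<Sum>\<rho>\<in>zeros_upto R. ord \<rho>) \<le> 4 * c * R"
proof -
  define N where "N = (\<Sum>\<rho>\<in>zeros_upto R. ord \<rho>)"
  obtain F where F: "\<And>z. f z = (\<Prod>\<rho>\<in>zeros_upto R. (1 - z / \<rho>) ^ ord \<rho>) * F z"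
      "\<And>z. norm z \<le> 4 * R \<Longrightarrow> 3 ^ N * norm (F z) \<le> exp (4 * c * R)"
    unfolding N_def by (rule factor_zeros_upto[OF R]) blast
  have "exp (real N) = exp 1 ^ N"
    by (simp flip: exp_of_nat_mult)
  also have "\<dots> \<le> 3 ^ N"
    by (intro power_mono) (use exp_le in auto)
  also have "\<dots> \<le> exp (4 * c * R)"
    using F(1)[of 0] F(2)[of 0] at_0 R by simp
  finally show ?thesis by (simp add: N_def)
qed

text \<open>Dyadic shells: the shell between r and 2 r contains O(r) zeros, each contributing at
  most r^(-k), so for \<open>k \<ge> 2\<close> the shells are dominated by a geometric
  series.\<close>

lemma abs_summable_zeros:
  assumes k: "k \<ge> 2"
  shows "(\<lambda>\<rho>. norm (of_nat (ord \<rho>) * (1 / \<rho> ^ k) :: complex)) summable_on {\<rho>. f \<rho> = 0}"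
proof -
  define \<delta> where "\<delta> = 1 / (8 * c)" \<comment> \<open>by the zero count there is no zero this close to 0\<close>
  have \<delta>: "\<delta> > 0" "4 * c * \<delta> < 1"
    using c_pos by (auto simp: \<delta>_def)
  have large: "norm \<rho> > \<delta>" if "f \<rho> = 0" for \<rho>
  proof (rule ccontr)
    assume "\<not> norm \<rho> > \<delta>"
    hence "real (ord \<rho>) \<le> real (\<Sum>\<rho>\<in>zeros_upto \<delta>. ord \<rho>)"
      using that finite_zeros[of \<delta>] member_le_sum[of \<rho> "zeros_upto \<delta>" ord] unfolding of_nat_le_iff by auto
    also have "\<dots> < 1"
      using zero_count_le[OF \<delta>(1)] \<delta>(2) by linarith
    finally show False
      using zorder_eq_ord[OF that] by simp
  qed
  define g where "g = (\<lambda>\<rho>. real (ord \<rho>) / norm \<rho> ^ k)"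
  \<comment> \<open>The shell from \<delta> 2^j to \<delta> 2^(j+1) contributes at most 4 c \<delta>
    2^(j+1) / (\<delta> 2^j)^k \<le> B / 2^(j+1); these bounds add up to \<open>B\<close>.\<close>
  define B where "B = 16 * c * \<delta> / \<delta> ^ k"
  have B: "B > 0"
    using c_pos \<delta> by (simp add: B_def)
  have dyadic: "(\<Sum>\<rho>\<in>zeros_upto (\<delta> * 2 ^ j). g \<rho>) \<le> B * (1 - 1 / 2 ^ j)" for j
  proof (induction j)
    case 0
    have "zeros_upto (\<delta> * 2 ^ 0) = {}"
      using large by force
    thus ?case by (simp only: sum.empty) simp
  next
    case (Suc j)
    let ?r = "\<delta> * 2 ^ j" and ?R = "\<delta> * 2 ^ Suc j"
    have sub: "zeros_upto ?r \<subseteq> zeros_upto ?R"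
    proof safe
      fix \<rho> :: complex assume "norm \<rho> \<le> ?r"
      also have "?r \<le> ?R" using \<delta>(1) by simp
      finally show "norm \<rho> \<le> ?R" .
    qed
    have r_pos: "?r > 0"
      using \<delta> by simp
    have "(\<Sum>\<rho>\<in>zeros_upto ?R - zeros_upto ?r. g \<rho>)
        \<le> (\<Sum>\<rho>\<in>zeros_upto ?R - zeros_upto ?r. real (ord \<rho>) / ?r ^ k)"
    proof (intro sum_mono)
      fix \<rho> assume "\<rho> \<in> zeros_upto ?R - zeros_upto ?r"
      hence "?r \<le> norm \<rho>"
        by auto
      hence "?r ^ k \<le> norm \<rho> ^ k" "0 < ?r ^ k"
        using r_pos by (auto intro: power_mono)
      thus "g \<rho> \<le> real (ord \<rho>) / ?r ^ k"
        unfolding g_def by (intro divide_left_mono mult_pos_pos) auto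
    qed
    also have "\<dots> \<le> (\<Sum>\<rho>\<in>zeros_upto ?R. real (ord \<rho>) / ?r ^ k)"
      by (intro sum_mono2 finite_zeros) (use r_pos in auto)
    also have "\<dots> = real (\<Sum>\<rho>\<in>zeros_upto ?R. ord \<rho>) / ?r ^ k"
      by (simp add: sum_divide_distrib)
    also have "\<dots> \<le> 4 * c * ?R / ?r ^ k"
      by (intro divide_right_mono zero_count_le) (use r_pos \<delta> in auto)
    also have "\<dots> = B / 2 ^ Suc j * (4 ^ j / (2 ^ j) ^ k)"
    proof -
      have "(4::real) ^ j = 2 ^ j * 2 ^ j"
        by (simp flip: power_mult_distrib)
      thus ?thesis
        by (simp add: B_def power_mult_distrib field_simps)
    qed
    also have "\<dots> \<le> B / 2 ^ Suc j * 1"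
    proof (intro mult_left_mono)
      have "(4::real) ^ j = (2 ^ j) ^ 2"
        by (simp flip: power_mult add: mult.commute[of j]) (simp add: power_mult)
      also have "\<dots> \<le> (2 ^ j) ^ k"
        by (intro power_increasing k) auto
      finally show "(4::real) ^ j / (2 ^ j) ^ k \<le> 1" by simp
    qed (use B in auto)
    finally have "(\<Sum>\<rho>\<in>zeros_upto ?R - zeros_upto ?r. g \<rho>) \<le> B / 2 ^ Suc j"
      by simp
    moreover have "sum g (zeros_upto ?R) = sum g (zeros_upto ?R - zeros_upto ?r) + sum g (zeros_upto ?r)"
      by (rule sum.subset_diff[OF sub finite_zeros])
    ultimately have "sum g (zeros_upto ?R) \<le> B / 2 ^ Suc j + B * (1 - 1 / 2 ^ j)"
      using Suc.IH by linarith
    also have "\<dots> = B * (1 - 1 / 2 ^ Suc j)"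
      by (simp add: field_simps)
    finally show ?case .
  qed
  have "g summable_on {\<rho>. f \<rho> = 0}"
  proof (rule nonneg_bounded_partial_sums_imp_summable_on)
    show "\<forall>\<^sub>F X in finite_subsets_at_top {\<rho>. f \<rho> = 0}. sum g X \<le> B"
    proof (rule eventually_finite_subsets_at_top_weakI)
      fix X assume X: "finite X" "X \<subseteq> {\<rho>. f \<rho> = 0}"
      have "\<exists>j. \<forall>\<rho>\<in>X. norm \<rho> \<le> \<delta> * 2 ^ j"
      proof -
        obtain j where j: "Max (insert 0 (norm ` X)) / \<delta> < 2 ^ j"
          using real_arch_pow[of 2] by auto
        have "norm \<rho> \<le> \<delta> * 2 ^ j" if "\<rho> \<in> X" for \<rho>
        proof -
          have "norm \<rho> \<le> Max (insert 0 (norm ` X))"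
            using that X by (intro Max_ge) auto
          thus ?thesis using j \<delta>(1) by (simp add: field_simps)
        qed
        thus ?thesis by blast
      qed
      then obtain j where j: "\<forall>\<rho>\<in>X. norm \<rho> \<le> \<delta> * 2 ^ j" by blast
      have "sum g X \<le> sum g (zeros_upto (\<delta> * 2 ^ j))"
        by (intro sum_mono2 finite_zeros) (use X j in \<open>auto simp: g_def\<close>)
      also have "\<dots> \<le> B * (1 - 1 / 2 ^ j)"
        by (rule dyadic)
      also have "\<dots> \<le> B * 1"
        by (intro mult_left_mono) (use B in auto)
      finally show "sum g X \<le> B" by simp
    qed
  qed (auto simp: g_def)
  thus ?thesis
    by (simp add: g_def norm_mult norm_divide norm_power)
qed

text \<open>
  After the zeros in the disc of radius \<open>R\<close> are divided out, the function has a logarithm there, whose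
  real part is \<open>O(R)\<close>; by Borel--Caratheodory its Taylor coefficient of index \<open>k + 1\<close> is then
  \<open>O(R ^ (- k))\<close>.
\<close>

lemma log_deriv_nth_estimate:
  assumes \<Phi>: "f has_fps_expansion \<Phi>" and R: "R > 0"
  shows "norm (fps_nth (fps_deriv \<Phi> * inverse \<Phi>) k
             + (\<Sum>\<rho>\<in>zeros_upto R. of_nat (ord \<rho>) * (1 / \<rho> ^ Suc k)))
         \<le> real (Suc k) * (2 * (4 * c * R + 1) * (2 / R) ^ Suc k)"
proof -
  obtain F where F: "F holomorphic_on UNIV"
    and f_eq: "\<And>z. f z = (\<Prod>\<rho>\<in>zeros_upto R. (1 - z / \<rho>) ^ ord \<rho>) * F z"
    and F_nz: "\<And>z. norm z \<le> R \<Longrightarrow> F z \<noteq> 0"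
    and F_le: "\<And>z. norm z \<le> 4 * R \<Longrightarrow>
       3 ^ (\<Sum>\<rho>\<in>zeros_upto R. ord \<rho>) * norm (F z) \<le> exp (4 * c * R)"
    using factor_zeros_upto[OF R] by blast
  have F0: "F 0 = 1"
    using f_eq[of 0] at_0 by simp
  obtain h0 where h0: "h0 holomorphic_on ball 0 R" "\<And>z. z \<in> ball 0 R \<Longrightarrow> exp (h0 z) = F z"
  proof (rule holomorphic_logarithm_exists[of "ball 0 R" F 0])
    show "F holomorphic_on ball 0 R"
      using F by (rule holomorphic_on_subset) auto
  qed (use F_nz R in auto)
  \<comment> \<open>\<open>h0 0\<close> may be a nonzero multiple of 2 \<pi> i; subtracting it gives
    the value 0 at 0 that Borel--Caratheodory asks for.\<close>
  define h where "h = (\<lambda>z. h0 z - h0 0)"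
  have h: "h holomorphic_on ball 0 R"
    unfolding h_def by (intro holomorphic_intros h0)
  have exp_h: "exp (h z) = F z" if "z \<in> ball 0 R" for z
    using h0(2)[OF that] h0(2)[of 0] R F0 by (simp add: h_def exp_diff)
  \<comment> \<open>The summand 1 makes the inequality strict.\<close>
  have Re_h: "Re (h z) < 4 * c * R + 1" if "norm z < R" for z
  proof -
    have "norm (F z) * 1 \<le> norm (F z) * 3 ^ (\<Sum>\<rho>\<in>zeros_upto R. ord \<rho>)"
      by (intro mult_left_mono one_le_power) auto
    also have "\<dots> \<le> exp (4 * c * R)"
      using F_le[of z] that R by (simp add: mult_ac)
    finally have "exp (Re (h z)) \<le> exp (4 * c * R)"
      using exp_h[of z] that by (metis mem_ball_0 mult.right_neutral norm_exp_eq_Re)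
    thus ?thesis by simp
  qed
  have h_le: "norm (h z) \<le> 2 * (4 * c * R + 1)" if "norm z \<le> R / 2" for z
    by (rule borel_caratheodory_norm_le[OF h R _ Re_h that]) (simp_all add: h_def)
  have coeff_le: "norm ((deriv ^^ Suc k) h 0) \<le> fact (Suc k) * (2 * (4 * c * R + 1)) / (R / 2) ^ Suc k"
  proof (rule Cauchy_inequality)
    show "h holomorphic_on ball 0 (R / 2)"
      by (rule holomorphic_on_subset[OF h]) (use R in auto)
    show "continuous_on (cball 0 (R / 2)) h"
      by (intro holomorphic_on_imp_continuous_on holomorphic_on_subset[OF h]) (use R in auto)
  qed (use h_le R in auto)

  define H where "H = fps_expansion h 0"
  have H: "h has_fps_expansion H"
    unfolding H_def by (intro analytic_at_imp_has_fps_expansion_0)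
      (use h R analytic_at[of h 0] open_ball centre_in_ball in blast)
  define \<Psi> where "\<Psi> = fps_expansion F 0"
  have \<Psi>: "F has_fps_expansion \<Psi>"
    unfolding \<Psi>_def by (intro analytic_at_imp_has_fps_expansion_0)
      (use F in \<open>auto simp: analytic_at\<close>)
  have \<Psi>_0: "fps_nth \<Psi> 0 = 1"
    using has_fps_expansion_imp_0_eq_fps_nth_0[OF \<Psi>] F0 by simp
  \<comment> \<open>\<open>F = exp h\<close> holds only on the disc, which suffices for power series
    at 0. From F' = h' F the logarithmic derivative of \<open>F\<close> is h', whose coefficients
    are bounded by Cauchy's inequality.\<close>
  have "fps_deriv \<Psi> = fps_deriv H * \<Psi>"
  proof (rule fps_expansion_unique_complex)
    show "deriv F has_fps_expansion fps_deriv \<Psi>"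
      by (intro fps_expansion_intros \<Psi>)
    have "\<forall>\<^sub>F z in nhds 0. z \<in> ball 0 R"
      by (rule eventually_nhds_in_open) (use R in auto)
    hence "\<forall>\<^sub>F z in nhds 0. deriv h z * F z = deriv F z"
    proof eventually_elim
      case (elim z)
      have "(h has_field_derivative deriv h z) (at z)"
        using h elim by (intro holomorphic_derivI[where S = "ball 0 R"]) auto
      hence "((\<lambda>z. exp (h z)) has_field_derivative exp (h z) * deriv h z) (at z)"
        by (auto intro!: derivative_eq_intros)
      hence "(F has_field_derivative exp (h z) * deriv h z) (at z)"
        by (rule has_field_derivative_transform_within_open[where S = "ball 0 R"])
           (use elim exp_h in auto)
      hence "deriv F z = exp (h z) * deriv h z"
        by (rule DERIV_imp_deriv)
      thus ?case
        using exp_h[OF elim] by simp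
    qed
    moreover have "(\<lambda>z. deriv h z * F z) has_fps_expansion fps_deriv H * \<Psi>"
      by (intro fps_expansion_intros \<Psi> H)
    ultimately show "deriv F has_fps_expansion fps_deriv H * \<Psi>"
      using has_fps_expansion_cong[of "\<lambda>z. deriv h z * F z" "deriv F"] by blast
  qed
  hence log_deriv_\<Psi>: "fps_deriv \<Psi> * inverse \<Psi> = fps_deriv H"
    using \<Psi>_0 by (simp add: mult.assoc inverse_mult_eq_1')
  define Q where "Q = (\<lambda>\<rho>. 1 - fps_const (1 / \<rho>) * fps_X :: complex fps)"
  define P where "P = (\<Prod>\<rho>\<in>zeros_upto R. Q \<rho> ^ ord \<rho>)"
  have "\<Phi> = P * \<Psi>"
  proof (rule fps_expansion_unique_complex[OF \<Phi>])
    have "(\<lambda>z. (\<Prod>\<rho>\<in>zeros_upto R. (1 - 1 / \<rho> * z) ^ ord \<rho>) * F z) has_fps_expansion P * \<Psi>"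
      unfolding P_def Q_def by (intro fps_expansion_intros \<Psi>)
    also have "(\<lambda>z. (\<Prod>\<rho>\<in>zeros_upto R. (1 - 1 / \<rho> * z) ^ ord \<rho>) * F z) = f"
      by (rule ext, subst f_eq) simp
    finally show "f has_fps_expansion P * \<Psi>" .
  qed
  moreover have P_0: "fps_nth P 0 = 1"
    unfolding P_def Q_def by (simp add: fps_prod_nth_0 fps_power_zeroth)
  ultimately have "fps_deriv \<Phi> * inverse \<Phi> = fps_deriv P * inverse P + fps_deriv \<Psi> * inverse \<Psi>"
    using fps_log_deriv_mult[of P \<Psi>] \<Psi>_0 by (simp del: fps_deriv_mult)
  also have "fps_deriv P * inverse P = (\<Sum>\<rho>\<in>zeros_upto R. of_nat (ord \<rho>) * (fps_deriv (Q \<rho>) * inverse (Q \<rho>)))"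
    unfolding P_def by (subst fps_log_deriv_prod_power) (auto simp: Q_def)
  finally have log_deriv: "fps_deriv \<Phi> * inverse \<Phi> =
      (\<Sum>\<rho>\<in>zeros_upto R. of_nat (ord \<rho>) * (fps_deriv (Q \<rho>) * inverse (Q \<rho>))) + fps_deriv H"
    by (simp add: log_deriv_\<Psi>)
  have "fps_nth (fps_deriv \<Phi> * inverse \<Phi>) k + (\<Sum>\<rho>\<in>zeros_upto R. of_nat (ord \<rho>) * (1 / \<rho> ^ Suc k))
      = fps_nth (fps_deriv H) k"
    unfolding log_deriv Q_def fps_log_deriv_linear
    by (simp add: fps_sum_nth sum_negf power_divide flip: fps_of_nat)
  also have "\<dots> = of_nat (Suc k) * ((deriv ^^ Suc k) h 0 / fact (Suc k))"
    by (simp add: H_def fps_expansion_def del: funpow.simps)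
  also have "norm \<dots> \<le> real (Suc k) * ((2 * (4 * c * R + 1)) / (R / 2) ^ Suc k)"
  proof -
    have "norm ((deriv ^^ Suc k) h 0 / fact (Suc k)) \<le> (2 * (4 * c * R + 1)) / (R / 2) ^ Suc k"
      using coeff_le by (simp add: norm_divide field_simps del: funpow.simps fact_Suc power_Suc)
    thus ?thesis
      unfolding norm_mult norm_of_nat by (intro mult_left_mono) auto
  qed
  also have "(2 * (4 * c * R + 1)) / (R / 2) ^ Suc k = 2 * (4 * c * R + 1) * (2 / R) ^ Suc k"
    by (simp add: power_divide del: power_Suc)
  finally show ?thesis .
qed

text \<open>Absolute summability allows the sum to be taken along discs of growing radius, where the
  preceding estimate controls the error. It is O(R^(-k)), which tends to 0 because
  \<open>k \<ge> 1\<close>.\<close>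

theorem has_sum_zeros:
  assumes \<Phi>: "f has_fps_expansion \<Phi>" and k: "k \<ge> 1"
  shows "((\<lambda>\<rho>. of_int (zorder f \<rho>) * (1 / \<rho> ^ Suc k)) has_sum
           - fps_nth (fps_deriv \<Phi> * inverse \<Phi>) k) {\<rho>. f \<rho> = 0}"
proof -
  define g where "g = (\<lambda>\<rho>. of_nat (ord \<rho>) * (1 / \<rho> ^ Suc k) :: complex)"
  define a where "a = fps_nth (fps_deriv \<Phi> * inverse \<Phi>) k"
  define S where "S = (\<Sum>\<^sub>\<infinity>\<rho>\<in>{\<rho>. f \<rho> = 0}. g \<rho>)"
  have "(\<lambda>\<rho>. norm (g \<rho>)) summable_on {\<rho>. f \<rho> = 0}"
    unfolding g_def by (rule abs_summable_zeros) (use k in simp)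
  hence "g summable_on {\<rho>. f \<rho> = 0}"
    by (rule abs_summable_summable)
  hence sum_S: "(g has_sum S) {\<rho>. f \<rho> = 0}"
    by (simp add: S_def)
  have "(\<lambda>n. sum g (zeros_upto (real n))) \<longlonglongrightarrow> S"
  proof (rule filterlim_compose[of "sum g" _ _ "\<lambda>n. zeros_upto (real n)"])
    show "(sum g \<longlongrightarrow> S) (finite_subsets_at_top {\<rho>. f \<rho> = 0})"
      using sum_S by (simp add: has_sum_def)
    show "filterlim (\<lambda>n. zeros_upto (real n)) (finite_subsets_at_top {\<rho>. f \<rho> = 0}) sequentially"
      unfolding filterlim_finite_subsets_at_top
    proof safe
      fix X assume X: "finite X" "X \<subseteq> {\<rho>. f \<rho> = 0}"
      have "\<forall>\<^sub>F n in sequentially. Max (insert 0 (norm ` X)) \<le> real n"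
        by (rule eventually_sequentiallyI[of "nat \<lceil>Max (insert 0 (norm ` X))\<rceil>"]) linarith
      thus "\<forall>\<^sub>F n in sequentially. finite (zeros_upto (real n)) \<and> X \<subseteq> zeros_upto (real n) \<and>
              zeros_upto (real n) \<subseteq> {\<rho>. f \<rho> = 0}"
      proof eventually_elim
        case (elim n)
        have "norm \<rho> \<le> real n" if "\<rho> \<in> X" for \<rho>
          using elim X that by (auto simp: Max_le_iff)
        thus ?case using X finite_zeros by auto
      qed
    qed
  qed
  moreover have "(\<lambda>n. sum g (zeros_upto (real n))) \<longlonglongrightarrow> -a"
  proof -
    define C where "C = real (Suc k) * (2 * (4 * c + 1) * 4)"
    have "(\<lambda>n. a + sum g (zeros_upto (real n))) \<longlonglongrightarrow> 0"
    proof (rule Lim_null_comparison)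
      show "(\<lambda>n. C / real n) \<longlonglongrightarrow> 0"
        by (rule lim_const_over_n)
      show "\<forall>\<^sub>F n in sequentially. norm (a + sum g (zeros_upto (real n))) \<le> C / real n"
        using eventually_ge_at_top[of 2]
      proof eventually_elim
        case (elim n)
        define R where "R = real n"
        have R: "R \<ge> 2" using elim by (simp add: R_def)
        have "norm (a + sum g (zeros_upto R)) \<le> real (Suc k) * (2 * (4 * c * R + 1) * (2 / R) ^ Suc k)"
          unfolding a_def g_def by (rule log_deriv_nth_estimate[OF \<Phi>]) (use R in auto)
        \<comment> \<open>For \<open>R \<ge> 2\<close> the base 2 / R is at most 1, so the exponent
          can be lowered to 2, and the 1 is absorbed into \<open>R\<close>; what remains is a
          multiple of 1 / R.\<close>
        also have "\<dots> \<le> real (Suc k) * (2 * (4 * c * R + R) * (2 / R) ^ 2)"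
          by (intro mult_left_mono mult_mono power_decreasing) (use R k c_pos in auto)
        also have "\<dots> = C / R"
          using R by (simp add: C_def field_simps power2_eq_square)
        finally show ?case by (simp add: R_def)
      qed
    qed
    from tendsto_diff[OF this tendsto_const[of a]] show ?thesis by simp
  qed
  ultimately have "S = -a"
    by (rule LIMSEQ_unique)
  moreover have "((\<lambda>\<rho>. of_int (zorder f \<rho>) * (1 / \<rho> ^ Suc k)) has_sum S) {\<rho>. f \<rho> = 0} \<longleftrightarrow>
      (g has_sum S) {\<rho>. f \<rho> = 0}"
    by (rule has_sum_cong) (use zorder_eq_ord in \<open>force simp: g_def\<close>)
  ultimately show ?thesis
    using sum_S by (simp add: a_def)
qed

end

subsection \<open>Hankel determinants and J-fractions\<close>

definition hankel_mat :: "nat \<Rightarrow> 'a fps \<Rightarrow> 'a mat" where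
  "hankel_mat n G = Matrix.mat n n (\<lambda>(i, j). fps_nth G (i + j))"

lemma hankel_mat_carrier [simp]: "hankel_mat n G \<in> carrier_mat n n"
  by (simp add: hankel_mat_def)

text \<open>
  A power series over \<^typ>\<open>'a fps\<close> is a bivariate series: the outer variable \<^const>\<open>fps_X\<close> is \<open>x\<close>, and
  \<open>fps_const fps_X\<close> is \<open>y\<close>. The Hankel matrix of \<open>F\<close> has the generating function
  \<open>(x F(x) - y F(y)) / (x - y)\<close>.
\<close>

definition fps_bivariate_hankel :: "'a :: comm_ring_1 fps \<Rightarrow> 'a fps fps" where
  "fps_bivariate_hankel F = Abs_fps (\<lambda>i. Abs_fps (\<lambda>j. fps_nth F (i + j)))"

text \<open>This is F(x), while \<open>fps_const F\<close> is F(y).\<close>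

definition fps_map_const :: "'a :: comm_ring_1 fps \<Rightarrow> 'a fps fps" where
  "fps_map_const F = Abs_fps (\<lambda>i. fps_const (fps_nth F i))"

lemma fps_map_const_mult: "fps_map_const (F * G) = fps_map_const F * fps_map_const G"
proof (rule fps_ext)
  fix n
  have "fps_const (\<Sum>i = 0..n. fps_nth F i * fps_nth G (n - i)) =
      (\<Sum>i = 0..n. fps_const (fps_nth F i) * fps_const (fps_nth G (n - i)))"
    by (simp add: fps_eq_iff fps_sum_nth)
  thus "fps_nth (fps_map_const (F * G)) n = fps_nth (fps_map_const F * fps_map_const G) n"
    by (simp add: fps_map_const_def fps_mult_nth)
qed

lemma fps_map_const_add: "fps_map_const (F + G) = fps_map_const F + fps_map_const G"
  and fps_map_const_diff: "fps_map_const (F - G) = fps_map_const F - fps_map_const G"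
  and fps_map_const_1: "fps_map_const 1 = 1"
  and fps_map_const_const: "fps_map_const (fps_const c) = fps_const (fps_const c)"
  and fps_map_const_X: "fps_map_const fps_X = fps_X"
  by (auto simp: fps_map_const_def fps_eq_iff fps_X_def)

lemma fps_bivariate_hankel_mult_diff:
  "(fps_X - fps_const fps_X) * fps_bivariate_hankel F =
     fps_X * fps_map_const F - fps_const fps_X * fps_const F"
proof (intro fps_ext)
  fix i j
  show "fps_nth (fps_nth ((fps_X - fps_const fps_X) * fps_bivariate_hankel F) i) j =
      fps_nth (fps_nth (fps_X * fps_map_const F - fps_const fps_X * fps_const F) i) j"
    by (cases i; cases j)
       (auto simp: fps_bivariate_hankel_def fps_map_const_def ring_distribs simp flip: fps_const_mult)
qed

text \<open>The hypothesis gives 1 / G(x) = 1 + b x - a x^2 h(x). Pulling G(x) G(y) out of x G(x) -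
  y G(y) leaves x / G(y) - y / G(x). There the two terms b x y cancel, and the rest is (x - y) + a x
  y (x h(x) - y h(y)). Dividing by x - y turns the last bracket into the generating function for
  \<open>h\<close>.\<close>

lemma fps_bivariate_hankel_J_fraction:
  fixes G h :: "'a :: idom fps"
  assumes G: "G * (1 + fps_const b * fps_X - fps_const a * (fps_X * (fps_X * h))) = 1"
  shows "fps_bivariate_hankel G = fps_map_const G *
     (1 + fps_const (fps_const a * fps_X) * (fps_X * fps_bivariate_hankel h)) * fps_const G"
proof -
  define x y :: "'a fps fps" where "x = fps_X" and "y = fps_const fps_X"
  define Gx Gy hx hy where "Gx = fps_map_const G" and "Gy = fps_const G"
    and "hx = fps_map_const h" and "hy = fps_const h"
  define A B :: "'a fps fps" where "A = fps_const (fps_const a)" and "B = fps_const (fps_const b)"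
  define K where "K = fps_bivariate_hankel h"
  have Gx: "Gx * (1 + B * x - A * (x * (x * hx))) = 1"
    using arg_cong[OF G, of fps_map_const]
    by (simp add: fps_map_const_mult fps_map_const_add fps_map_const_diff fps_map_const_1
          fps_map_const_const fps_map_const_X Gx_def hx_def A_def B_def x_def)
  have Gy: "Gy * (1 + B * y - A * (y * (y * hy))) = 1"
    using arg_cong[OF G, of fps_const]
    by (simp add: Gy_def hy_def A_def B_def y_def flip: fps_const_mult fps_const_add fps_const_sub)
  have "(x - y) * fps_bivariate_hankel G = x * Gx - y * Gy"
    by (simp add: fps_bivariate_hankel_mult_diff x_def y_def Gx_def Gy_def)
  also have "\<dots> = x * Gx * (Gy * (1 + B * y - A * (y * (y * hy)))) -
      y * Gy * (Gx * (1 + B * x - A * (x * (x * hx))))"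
    by (simp add: Gx Gy)
  also have "\<dots> = Gx * Gy * ((x - y) + A * x * y * (x * hx - y * hy))"
    by (simp add: algebra_simps)
  also have "x * hx - y * hy = (x - y) * K"
    by (simp add: fps_bivariate_hankel_mult_diff x_def y_def hx_def hy_def K_def)
  also have "Gx * Gy * ((x - y) + A * x * y * ((x - y) * K)) =
      (x - y) * (Gx * (1 + A * y * (x * K)) * Gy)"
    by (simp add: algebra_simps)
  finally have "(x - y) * fps_bivariate_hankel G = (x - y) * (Gx * (1 + A * y * (x * K)) * Gy)" .
  moreover have "x - y \<noteq> 0"
  proof
    assume "x - y = 0"
    hence "fps_nth (x - y) 1 = 0" by simp
    thus False by (simp add: x_def y_def)
  qed
  ultimately have "fps_bivariate_hankel G = Gx * (1 + A * y * (x * K)) * Gy"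
    by simp
  thus ?thesis
    by (simp add: x_def y_def Gx_def Gy_def A_def K_def)
qed

section \<open>From the factorised generating function to determinants\<close>

lemma mult_mat_index:
  assumes "A \<in> carrier_mat n n" "B \<in> carrier_mat n n" "i < n" "j < n"
  shows "(A * B) $$ (i, j) = (\<Sum>l<n. A $$ (i, l) * B $$ (l, j))"
  using assms by (auto simp: scalar_prod_def atLeast0LessThan intro!: sum.cong)

text \<open>Read coefficientwise, the bivariate factorisation is a congruence T D T^t with the lower
  triangular Toeplitz matrix \<open>T\<close> of \<open>G\<close>. The hypothesis forces constant
  coefficient 1, so \<open>T\<close> has determinant 1. The case \<open>a = 0\<close> is
  included.\<close>

lemma det_hankel_J_fraction:
  fixes G h :: "'a :: idom fps"
  assumes G: "G * (1 + fps_const b * fps_X - fps_const a * (fps_X * (fps_X * h))) = 1"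
  shows "Determinant.det (hankel_mat (Suc n) G) = a ^ n * Determinant.det (hankel_mat n h)"
proof -
  define M where "M = 1 + fps_const (fps_const a * fps_X) * (fps_X * fps_bivariate_hankel h)"
  define T where "T = Matrix.mat (Suc n) (Suc n) (\<lambda>(i, k). if k \<le> i then fps_nth G (i - k) else 0)"
  define D where "D = Matrix.mat (Suc n) (Suc n) (\<lambda>(k, l). fps_nth (fps_nth M k) l)"
  have [simp]: "T \<in> carrier_mat (Suc n) (Suc n)" "D \<in> carrier_mat (Suc n) (Suc n)"
    "dim_row T = Suc n" "dim_col T = Suc n"
    by (simp_all add: T_def D_def)
  have M_nth: "fps_nth (fps_nth M k) l =
      (if k = 0 then if l = 0 then 1 else 0
       else if l = 0 then 0 else a * fps_nth h (k - 1 + (l - 1)))" for k l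
    by (cases k; cases l) (auto simp: M_def fps_bivariate_hankel_def mult.assoc)
  \<comment> \<open>Multiplication by G(x) convolves in the outer index and multiplication by G(y)
    in the inner one; these become the left and the right triangular factor.\<close>
  have G_nth: "fps_nth G (i + j) =
      (\<Sum>k\<le>i. \<Sum>l\<le>j. fps_nth G (i - k) * fps_nth (fps_nth M k) l * fps_nth G (j - l))" for i j
  proof -
    have "fps_nth G (i + j) = fps_nth (fps_nth (fps_bivariate_hankel G) i) j"
      by (simp add: fps_bivariate_hankel_def)
    also have "fps_bivariate_hankel G = M * fps_map_const G * fps_const G"
      unfolding fps_bivariate_hankel_J_fraction[OF G] M_def by (simp add: mult_ac)
    also have "fps_nth (fps_nth (M * fps_map_const G * fps_const G) i) j =
        (\<Sum>k\<le>i. fps_nth (fps_nth M k * fps_const (fps_nth G (i - k)) * G) j)"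
      by (simp add: fps_mult_nth[of M] fps_map_const_def sum_distrib_right fps_sum_nth atLeast0AtMost)
    also have "\<dots> = (\<Sum>k\<le>i. \<Sum>l\<le>j. fps_nth G (i - k) * fps_nth (fps_nth M k) l * fps_nth G (j - l))"
      by (simp add: fps_mult_nth[of _ G] atLeast0AtMost) (simp add: mult_ac)
    finally show ?thesis .
  qed
  have "hankel_mat (Suc n) G = T * D * transpose_mat T"
  proof (rule eq_matI)
    fix i j assume "i < dim_row (T * D * transpose_mat T)" "j < dim_col (T * D * transpose_mat T)"
    hence ij: "i < Suc n" "j < Suc n"
      by (simp_all add: T_def)
    have TD: "(T * D) $$ (i, l) = (\<Sum>k\<le>i. fps_nth G (i - k) * fps_nth (fps_nth M k) l)" if "l < Suc n" for l
    proof -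
      have "(T * D) $$ (i, l) = (\<Sum>k<Suc n. (if k \<le> i then fps_nth G (i - k) * fps_nth (fps_nth M k) l else 0))"
        using ij that by (subst mult_mat_index[of _ "Suc n"]) (auto simp: T_def D_def intro!: sum.cong)
      also have "\<dots> = (\<Sum>k\<le>i. fps_nth G (i - k) * fps_nth (fps_nth M k) l)"
        using ij by (intro sum.mono_neutral_cong_right) auto
      finally show ?thesis .
    qed
    have "(T * D * transpose_mat T) $$ (i, j) = (\<Sum>l<Suc n. (T * D) $$ (i, l) * T $$ (j, l))"
      using ij by (subst mult_mat_index[of "T * D" "Suc n"])
        (auto simp del: index_mult_mat(1) sum.lessThan_Suc intro!: sum.cong mult_carrier_mat[of _ _ "Suc n"])
    also have "\<dots> = (\<Sum>l<Suc n. (if l \<le> j then (T * D) $$ (i, l) * fps_nth G (j - l) else 0))"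
      using ij by (intro sum.cong) (auto simp: T_def)
    also have "\<dots> = (\<Sum>l\<le>j. (T * D) $$ (i, l) * fps_nth G (j - l))"
      using ij by (intro sum.mono_neutral_cong_right) auto
    also have "\<dots> = (\<Sum>l\<le>j. \<Sum>k\<le>i. fps_nth G (i - k) * fps_nth (fps_nth M k) l * fps_nth G (j - l))"
      using ij by (intro sum.cong) (auto simp: TD sum_distrib_right simp del: index_mult_mat(1))
    also have "\<dots> = fps_nth G (i + j)"
      unfolding G_nth by (rule sum.swap)
    finally show "hankel_mat (Suc n) G $$ (i, j) = (T * D * transpose_mat T) $$ (i, j)"
      using ij by (simp add: hankel_mat_def del: index_mult_mat(1))
  qed (simp_all add: hankel_mat_def T_def)
  moreover have "T * D \<in> carrier_mat (Suc n) (Suc n)"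
    by (rule mult_carrier_mat[of _ _ "Suc n"]) simp_all
  ultimately have "Determinant.det (hankel_mat (Suc n) G) =
      Determinant.det T * Determinant.det D * Determinant.det (transpose_mat T)"
    by (simp add: det_mult[of _ "Suc n"])
  also have "Determinant.det (transpose_mat T) = Determinant.det T"
    by (rule det_transpose[of _ "Suc n"]) simp
  also have "Determinant.det T = 1"
  proof -
    have "fps_nth (G * (1 + fps_const b * fps_X - fps_const a * (fps_X * (fps_X * h)))) 0 = 1"
      by (simp add: G)
    hence G0: "fps_nth G 0 = 1" by simp
    have "Determinant.det T = prod_list (diag_mat T)"
      by (rule det_lower_triangular[of "Suc n"]) (auto simp: T_def)
    also have "diag_mat T = replicate (Suc n) 1"
      by (rule nth_equalityI) (auto simp: diag_mat_def T_def G0 simp del: upt_Suc replicate_Suc)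
    finally show ?thesis by simp
  qed
  also have "Determinant.det D = a ^ n * Determinant.det (hankel_mat n h)"
  proof -
    \<comment> \<open>The factor x y in front of the generating function for \<open>h\<close> shifts
      its matrix by one row and one column and leaves the border of an identity matrix.\<close>
    have "D = four_block_mat (1\<^sub>m 1) (0\<^sub>m 1 n) (0\<^sub>m n 1) (a \<cdot>\<^sub>m hankel_mat n h)"
      by (rule eq_matI) (auto simp: D_def M_nth hankel_mat_def four_block_mat_def Let_def)
    also have "Determinant.det \<dots> = Determinant.det (1\<^sub>m 1 :: 'a mat) * Determinant.det (a \<cdot>\<^sub>m hankel_mat n h)"
      by (rule det_four_block_mat_lower_left_zero[of _ 1 _ n]) auto
    also have "\<dots> = a ^ n * Determinant.det (hankel_mat n h)"
      by (simp add: hankel_mat_def)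
    finally show ?thesis .
  qed
  finally show ?thesis by simp
qed

subsection \<open>Contiguous relations of Kummer's function\<close>

text \<open>The Taylor series in z of 1F1(a; b; t z); keeping the scale \<open>t\<close> as a
  parameter avoids substitution into power series.\<close>

definition kummer_fps :: "complex \<Rightarrow> complex \<Rightarrow> complex \<Rightarrow> complex fps" where
  "kummer_fps a b t = Abs_fps (\<lambda>m. pochhammer a m / pochhammer b m * (t ^ m / fact m))"

lemma kummer_fps_nth_0 [simp]: "fps_nth (kummer_fps a b t) 0 = 1"
  by (simp add: kummer_fps_def)

lemma kummer_fps_nth: "fps_nth (kummer_fps a b t) m = pochhammer a m / pochhammer b m * (t ^ m / fact m)"
  by (simp add: kummer_fps_def)

lemma pochhammer_nonzero:
  fixes b :: complex
  assumes "\<And>m. b + of_nat m \<noteq> 0"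
  shows "pochhammer b n \<noteq> 0"
  using assms by (metis add_eq_0_iff2 pochhammer_eq_0_iff)

text \<open>Replacing L by L + 1 moves (a, b) to (a + 1, b + 2), so the derivative has to be
  expressed through these two functions rather than through the usual neighbour (a + 1, b +
  1).\<close>

lemma fps_deriv_kummer_fps:
  assumes b: "\<And>m. b + of_nat m \<noteq> 0"
  shows "fps_deriv (kummer_fps a b t) = fps_const (t * a / b) * kummer_fps a b t +
    fps_const (t\<^sup>2 * a * (b - a) / (b\<^sup>2 * (b + 1))) * (fps_X * kummer_fps (a + 1) (b + 2) t)"
proof (rule fps_ext)
  fix n
  show "fps_nth (fps_deriv (kummer_fps a b t)) n = fps_nth (fps_const (t * a / b) * kummer_fps a b t +
    fps_const (t\<^sup>2 * a * (b - a) / (b\<^sup>2 * (b + 1))) * (fps_X * kummer_fps (a + 1) (b + 2) t)) n"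
  proof (cases n)
    case 0
    thus ?thesis by (simp add: kummer_fps_def)
  next
    case (Suc m)
    \<comment> \<open>All Pochhammer symbols are rational multiples of those of the shifted
      function, so a common factor can be split off and a rational identity in \<open>a\<close>,
      \<open>b\<close> and \<open>m\<close> remains.\<close>
    define u v where "u = pochhammer (a + 1) m" and "v = pochhammer (b + 2) m"
    define T where "T = t ^ m / fact m"
    have pa1: "pochhammer a (Suc m) = a * u"
      by (simp add: u_def pochhammer_rec)
    have pa2: "pochhammer a (Suc (Suc m)) = a * u * (a + 1 + of_nat m)"
      by (subst pochhammer_Suc) (simp add: pa1 add_ac)
    have pb2: "pochhammer b (Suc (Suc m)) = b * (b + 1) * v"
      by (simp add: pochhammer_rec v_def add_ac)
    moreover have "pochhammer b (Suc (Suc m)) = pochhammer b (Suc m) * (b + 1 + of_nat m)"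
      by (subst pochhammer_Suc) (simp add: add_ac)
    moreover have nz: "b \<noteq> 0" "b + 1 \<noteq> 0" "b + 1 + of_nat m \<noteq> 0"
      using b[of 0] b[of 1] b[of "Suc m"] by (simp_all add: add_ac)
    ultimately have pb1: "pochhammer b (Suc m) = b * (b + 1) * v / (b + 1 + of_nat m)"
      by (simp add: field_simps)
    have v: "v \<noteq> 0"
      unfolding v_def by (rule pochhammer_nonzero) (use b[of "m + 2" for m] in \<open>simp add: add_ac\<close>)
    have T1: "t ^ Suc m / fact (Suc m) = t * T / of_nat (Suc m)"
      and T2: "t ^ Suc (Suc m) / fact (Suc (Suc m)) = t\<^sup>2 * T / (of_nat (Suc (Suc m)) * of_nat (Suc m))"
      by (simp_all add: T_def power2_eq_square field_simps del: of_nat_Suc)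
    have m_nz: "of_nat (Suc m) \<noteq> (0 :: complex)" "of_nat (Suc (Suc m)) \<noteq> (0 :: complex)"
      by (simp_all del: of_nat_Suc)
    have LHS: "fps_nth (fps_deriv (kummer_fps a b t)) n =
        t\<^sup>2 * T * u / (b * v) * (a * (a + 1 + of_nat m) / ((b + 1) * of_nat (Suc m)))"
    proof -
      have "fps_nth (fps_deriv (kummer_fps a b t)) n = of_nat (Suc (Suc m)) *
          (pochhammer a (Suc (Suc m)) / pochhammer b (Suc (Suc m)) * (t ^ Suc (Suc m) / fact (Suc (Suc m))))"
        by (simp only: Suc fps_deriv_nth kummer_fps_def fps_nth_Abs_fps Suc_eq_plus1[symmetric])
      also have "\<dots> = pochhammer a (Suc (Suc m)) / pochhammer b (Suc (Suc m)) *
          (of_nat (Suc (Suc m)) * (t ^ Suc (Suc m) / fact (Suc (Suc m))))"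
        by (simp only: mult_ac)
      also have "of_nat (Suc (Suc m)) * (t ^ Suc (Suc m) / fact (Suc (Suc m))) = t\<^sup>2 * T / of_nat (Suc m)"
        unfolding T2 using m_nz by (simp del: of_nat_Suc)
      finally show ?thesis
        unfolding pa2 pb2 by (simp add: mult_ac del: of_nat_Suc)
    qed
    have RHS: "fps_nth (fps_const (t * a / b) * kummer_fps a b t +
        fps_const (t\<^sup>2 * a * (b - a) / (b\<^sup>2 * (b + 1))) * (fps_X * kummer_fps (a + 1) (b + 2) t)) n =
        t\<^sup>2 * T * u / (b * v) * (a\<^sup>2 * (b + 1 + of_nat m) / (b * (b + 1) * of_nat (Suc m)) +
          a * (b - a) / (b * (b + 1)))"
    proof -
      have "fps_nth (fps_const (t * a / b) * kummer_fps a b t +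
        fps_const (t\<^sup>2 * a * (b - a) / (b\<^sup>2 * (b + 1))) * (fps_X * kummer_fps (a + 1) (b + 2) t)) n =
        t * a / b * (a * u / (b * (b + 1) * v / (b + 1 + of_nat m)) * (t * T / of_nat (Suc m))) +
        t\<^sup>2 * a * (b - a) / (b\<^sup>2 * (b + 1)) * (u / v * T)"
        by (simp only: Suc fps_add_nth fps_mult_left_const_nth fps_X_mult_nth kummer_fps_nth nat.distinct(2)
              if_False diff_Suc_1 pa1 pb1 T1 u_def[symmetric] v_def[symmetric] T_def[symmetric])
      also have "\<dots> = t\<^sup>2 * T * u / (b * v) * (a\<^sup>2 * (b + 1 + of_nat m) / (b * (b + 1) * of_nat (Suc m)) +
          a * (b - a) / (b * (b + 1)))"
      proof -
        \<comment> \<open>The sums among the factors are replaced by variables, so that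
          \<open>distrib_left\<close> does not expand them.\<close>
        have "t * a / b * (a * u / (b * e * v / q) * (t * T / s)) + t\<^sup>2 * a * d / (b\<^sup>2 * e) * (u / v * T) =
            t\<^sup>2 * T * u / (b * v) * (a\<^sup>2 * q / (b * e * s) + a * d / (b * e))" for d e q s
          by (simp add: distrib_left add_divide_distrib power2_eq_square mult_ac)
        thus ?thesis .
      qed
      finally show ?thesis .
    qed
    have "a * (a + 1 + of_nat m) / ((b + 1) * of_nat (Suc m)) =
        a\<^sup>2 * (b + 1 + of_nat m) / (b * (b + 1) * of_nat (Suc m)) + a * (b - a) / (b * (b + 1))"
      using m_nz(1) nz by (simp add: divide_simps del: of_nat_Suc) (simp add: algebra_simps power2_eq_square)
    thus ?thesis
      by (simp only: LHS RHS)
  qed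
qed

text \<open>The contiguous relation along the direction (1, 2). The coefficients of index 1 and 2
  determine the two constants; the same comparison at every higher index is again a rational
  identity.\<close>

lemma kummer_fps_three_term:
  assumes b: "\<And>m. b + of_nat m \<noteq> 0"
  shows "kummer_fps a b t =
    kummer_fps (a + 1) (b + 2) t +
    fps_const (t * (2 * a - b) / (b * (b + 2))) * (fps_X * kummer_fps (a + 1) (b + 2) t) +
    fps_const (t\<^sup>2 * (a + 1) * (b + 1 - a) / ((b + 1) * (b + 2)\<^sup>2 * (b + 3))) *
      (fps_X * (fps_X * kummer_fps (a + 2) (b + 4) t))"
    (is "_ = ?R")
proof (rule fps_ext)
  fix n
  have nz: "b \<noteq> 0" "b + 1 \<noteq> 0" "b + 2 \<noteq> 0" "b + 3 \<noteq> 0"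
    using b[of 0] b[of 1] b[of 2] b[of 3] by simp_all
  consider "n = 0" | "n = 1" | m where "n = Suc (Suc m)"
    by (metis One_nat_def not0_implies_Suc)
  thus "fps_nth (kummer_fps a b t) n = fps_nth ?R n"
  proof cases
    case 1
    thus ?thesis by (simp add: kummer_fps_def)
  next
    case 2
    thus ?thesis using nz by (simp add: kummer_fps_def divide_simps) (simp add: algebra_simps)
  next
    case (3 m)
    define u v where "u = pochhammer (a + 2) m" and "v = pochhammer (b + 4) m"
    define T where "T = t ^ m / fact m"
    define N :: complex where "N = of_nat m"
    have nz': "b + 2 + N \<noteq> 0" "b + 3 + N \<noteq> 0" "N + 1 \<noteq> 0" "N + 2 \<noteq> 0"
      using b[of "m + 2"] b[of "m + 3"] of_nat_neq_0[where ?'a = complex, of m]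
        of_nat_neq_0[where ?'a = complex, of "Suc m"] by (simp_all add: N_def add_ac)
    have v: "v \<noteq> 0"
      unfolding v_def by (rule pochhammer_nonzero) (use b[of "m + 4" for m] in \<open>simp add: add_ac\<close>)
    have pa: "pochhammer a (Suc (Suc m)) = a * (a + 1) * u"
      "pochhammer (a + 1) (Suc m) = (a + 1) * u"
      by (simp_all add: pochhammer_rec u_def add_ac)
    have pa2: "pochhammer (a + 1) (Suc (Suc m)) = (a + 1) * u * (a + 2 + N)"
      unfolding pochhammer_Suc[of "a + 1" "Suc m"] pa N_def by (simp add: add_ac)
    have pb2: "pochhammer (b + 2) (Suc (Suc m)) = (b + 2) * (b + 3) * v"
      by (simp add: pochhammer_rec v_def add_ac)
    moreover have "pochhammer (b + 2) (Suc (Suc m)) = pochhammer (b + 2) (Suc m) * (b + 3 + N)"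
      by (subst pochhammer_Suc) (simp add: N_def add_ac)
    ultimately have pb1: "pochhammer (b + 2) (Suc m) = (b + 2) * (b + 3) * v / (b + 3 + N)"
      using nz' by (simp add: field_simps)
    have "pochhammer b (Suc (Suc (Suc (Suc m)))) = b * (b + 1) * (b + 2) * (b + 3) * v"
      by (simp add: pochhammer_rec v_def add_ac)
    moreover have "pochhammer b (Suc (Suc (Suc (Suc m)))) =
        pochhammer b (Suc (Suc m)) * (b + 2 + N) * (b + 3 + N)"
      by (subst pochhammer_Suc, subst pochhammer_Suc) (simp add: N_def add_ac)
    ultimately have pb: "pochhammer b (Suc (Suc m)) =
        b * (b + 1) * (b + 2) * (b + 3) * v / ((b + 2 + N) * (b + 3 + N))"
      using nz' by (subst nonzero_eq_divide_eq) (simp_all add: mult.assoc)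
    have T1: "t ^ Suc m / fact (Suc m) = t * T / (N + 1)"
      and T2: "t ^ Suc (Suc m) / fact (Suc (Suc m)) = t\<^sup>2 * T / ((N + 2) * (N + 1))"
      by (simp_all add: T_def N_def power2_eq_square add_ac mult_ac)
    define W where "W = t\<^sup>2 * T * ((a + 1) * u / ((b + 2) * (b + 3) * v))"
    have L: "fps_nth (kummer_fps a b t) n =
        W * (a * (b + 2 + N) * (b + 3 + N) / (b * (b + 1) * ((N + 2) * (N + 1))))"
      by (simp only: 3 kummer_fps_nth pa pb T2) (simp add: W_def mult_ac)
    have R: "fps_nth ?R n = W * ((a + 2 + N) / ((N + 2) * (N + 1)) +
        (2 * a - b) * (b + 3 + N) / (b * (b + 2) * (N + 1)) +
        (b + 1 - a) / ((b + 1) * (b + 2)))"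
    proof -
      have "fps_nth ?R n = (a + 1) * u * (a + 2 + N) / ((b + 2) * (b + 3) * v) * (t\<^sup>2 * T / ((N + 2) * (N + 1)))
        + t * (2 * a - b) / (b * (b + 2)) * ((a + 1) * u / ((b + 2) * (b + 3) * v / (b + 3 + N)) * (t * T / (N + 1)))
        + t\<^sup>2 * (a + 1) * (b + 1 - a) / ((b + 1) * (b + 2)\<^sup>2 * (b + 3)) * (u / v * T)"
        by (simp only: 3 fps_add_nth fps_mult_left_const_nth fps_X_mult_nth kummer_fps_nth nat.distinct(2)
              if_False diff_Suc_1 pa2 pa(2) pb1 pb2 T1 T2 u_def[symmetric] v_def[symmetric] T_def[symmetric])
      also have "\<dots> = W * ((a + 2 + N) / ((N + 2) * (N + 1)) +
        (2 * a - b) * (b + 3 + N) / (b * (b + 2) * (N + 1)) +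
        (b + 1 - a) / ((b + 1) * (b + 2)))"
      proof -
        have "p * u * x / (q * r * v) * (t\<^sup>2 * T / (m2 * m1))
            + t * g / (b * q) * (p * u / (q * r * v / y) * (t * T / m1))
            + t\<^sup>2 * p * d / (e * q\<^sup>2 * r) * (u / v * T) =
            t\<^sup>2 * T * (p * u / (q * r * v)) * (x / (m2 * m1) + g * y / (b * q * m1) + d / (e * q))"
          for p q r x y m1 m2 g d e
          by (simp add: distrib_left add_divide_distrib power2_eq_square mult_ac)
        thus ?thesis
          unfolding W_def .
      qed
      finally show ?thesis .
    qed
    have "a * (b + 2 + N) * (b + 3 + N) / (b * (b + 1) * ((N + 2) * (N + 1))) =
        (a + 2 + N) / ((N + 2) * (N + 1)) +
        (2 * a - b) * (b + 3 + N) / (b * (b + 2) * (N + 1)) +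
        (b + 1 - a) / ((b + 1) * (b + 2))"
      using nz nz' by (simp add: divide_simps) (simp add: algebra_simps)
    thus ?thesis
      by (simp only: L R)
  qed
qed

text \<open>The quotients (a + m) / (b + m) converge and hence are bounded, so the Pochhammer ratio
  grows at most geometrically. Bounds of the shape K^m / m! sum to exp (K |z|) without a further
  constant, as \<open>exponential_type\<close> demands.\<close>

lemma kummer_fps_nth_bound:
  assumes b: "\<And>m. b + of_nat m \<noteq> 0"
  obtains K where "K > 0" "\<And>m. norm (fps_nth (kummer_fps a b t) m) \<le> K ^ m / fact m"
proof -
  have "(\<lambda>m. 1 + (a - b) / (b + of_nat m)) \<longlonglongrightarrow> 1 + 0"
    by (intro tendsto_intros tendsto_divide_0[OF tendsto_const]
          tendsto_add_filterlim_at_infinity[OF tendsto_const tendsto_of_nat])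
  hence "Bseq (\<lambda>m. 1 + (a - b) / (b + of_nat m))"
    by (intro convergent_imp_Bseq) (auto simp: convergent_def)
  then obtain C where C: "C > 0" "\<And>m. norm (1 + (a - b) / (b + of_nat m)) \<le> C"
    by (auto simp: Bseq_def)
  have ratio: "norm (pochhammer a m / pochhammer b m) \<le> C ^ m" for m
  proof (induction m)
    case (Suc m)
    have "pochhammer a (Suc m) / pochhammer b (Suc m) =
        pochhammer a m / pochhammer b m * (1 + (a - b) / (b + of_nat m))"
      using b[of m] by (simp add: pochhammer_Suc field_simps)
    hence "norm (pochhammer a (Suc m) / pochhammer b (Suc m)) =
        norm (pochhammer a m / pochhammer b m) * norm (1 + (a - b) / (b + of_nat m))"
      by (simp only: norm_mult)
    also have "\<dots> \<le> C ^ m * C"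
      by (intro mult_mono Suc C) (use C in auto)
    finally show ?case by (simp add: mult.commute)
  qed auto
  show ?thesis
  proof (rule that[of "C * (norm t + 1)"])
    show "C * (norm t + 1) > 0"
      using C by (intro mult_pos_pos) (auto simp: add_nonneg_pos)
    fix m
    have "norm (fps_nth (kummer_fps a b t) m) = norm (pochhammer a m / pochhammer b m) * (norm t ^ m / fact m)"
      by (simp add: kummer_fps_def norm_mult norm_divide norm_power)
    also have "\<dots> \<le> C ^ m * ((norm t + 1) ^ m / fact m)"
      by (intro mult_mono ratio divide_right_mono power_mono) (use C in auto)
    finally show "norm (fps_nth (kummer_fps a b t) m) \<le> (C * (norm t + 1)) ^ m / fact m"
      by (simp add: power_mult_distrib)
  qed
qed

lemma kummer_fps_exponential_type:
  assumes b: "\<And>m. b + of_nat m \<noteq> 0"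
  shows "fps_conv_radius (kummer_fps a b t) = \<infinity>"
    and "\<exists>K>0. \<forall>z. norm (eval_fps (kummer_fps a b t) z) \<le> exp (K * norm z)"
proof -
  obtain K where K: "K > 0" "\<And>m. norm (fps_nth (kummer_fps a b t) m) \<le> K ^ m / fact m"
    using kummer_fps_nth_bound[OF b] by blast
  have term_le: "norm (fps_nth (kummer_fps a b t) m * z ^ m) \<le> (K * norm z) ^ m /\<^sub>R fact m" for m z
  proof -
    have "norm (fps_nth (kummer_fps a b t) m) * norm z ^ m \<le> K ^ m / fact m * norm z ^ m"
      by (intro mult_right_mono K) auto
    thus ?thesis by (simp add: norm_mult norm_power power_mult_distrib field_simps)
  qed
  have exp_sums: "(\<lambda>m. (K * norm z) ^ m /\<^sub>R fact m) sums exp (K * norm z)" for z :: complex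
    by (rule exp_converges)
  have summ: "summable (\<lambda>m. norm (fps_nth (kummer_fps a b t) m * z ^ m))" for z
    by (rule summable_comparison_test'[OF sums_summable[OF exp_sums[of z]], of 0]) (use term_le in auto)
  show "fps_conv_radius (kummer_fps a b t) = \<infinity>"
    unfolding fps_conv_radius_def by (rule conv_radius_inftyI'') (rule summable_norm_cancel[OF summ])
  have "norm (eval_fps (kummer_fps a b t) z) \<le> exp (K * norm z)" for z
  proof -
    have "norm (eval_fps (kummer_fps a b t) z) \<le> (\<Sum>m. norm (fps_nth (kummer_fps a b t) m * z ^ m))"
      unfolding eval_fps_def by (rule summable_norm[OF summ])
    also have "\<dots> \<le> (\<Sum>m. (K * norm z) ^ m /\<^sub>R fact m)"
      by (intro suminf_le term_le summ sums_summable[OF exp_sums])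
    also have "\<dots> = exp (K * norm z)"
      using exp_sums by (rule sums_unique[symmetric])
    finally show ?thesis .
  qed
  thus "\<exists>K>0. \<forall>z. norm (eval_fps (kummer_fps a b t) z) \<le> exp (K * norm z)"
    using K(1) by blast
qed

subsection \<open>The Coulomb zeta function\<close>

text \<open>The factor \<open>exp (- \<i> * \<rho>)\<close> is left out, as it cancels in \<open>coulomb_ratio\<close>.\<close>

definition coulomb_fps :: "complex \<Rightarrow> complex \<Rightarrow> complex fps" where
  "coulomb_fps L \<eta> = kummer_fps (L + 1 - \<i> * \<eta>) (2 * L + 2) (2 * \<i>)"

definition coulomb_coeff :: "complex \<Rightarrow> complex \<Rightarrow> complex" where
  "coulomb_coeff L \<eta> = (1 + \<eta>\<^sup>2 / (L + 1)\<^sup>2) / (2 * L + 3)"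

definition coulomb_ratio :: "complex \<Rightarrow> complex \<Rightarrow> complex fps" where
  "coulomb_ratio L \<eta> = coulomb_fps (L + 1) \<eta> * inverse (coulomb_fps L \<eta>)"

lemma coulomb_fps_nth_0 [simp]: "fps_nth (coulomb_fps L \<eta>) 0 = 1"
  by (simp add: coulomb_fps_def)

section \<open>Specialisation of the contiguous relations to the Coulomb parameters\<close>

context
  fixes L :: complex
  assumes L: "\<And>m. 2 * L + 2 + of_nat m \<noteq> 0"
begin

lemma coulomb_nonzero: "L + 1 \<noteq> 0" "L + 2 \<noteq> 0" "2 * L + 3 \<noteq> 0" "2 * L + 5 \<noteq> 0"
proof -
  show "2 * L + 3 \<noteq> 0" "2 * L + 5 \<noteq> 0"
    using L[of 1] L[of 3] by (simp_all add: add.assoc)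
  have "2 * L + 2 + of_nat 0 = 2 * (L + 1)" "2 * L + 2 + of_nat 2 = 2 * (L + 2)"
    by simp_all
  thus "L + 1 \<noteq> 0" "L + 2 \<noteq> 0"
    using L[of 0] L[of 2] by (metis mult_zero_right)+
qed

text \<open>Here a (b - a) = (L + 1 - i \<eta>) (L + 1 + i \<eta>) = (L + 1)^2 + \<eta>^2, which is
  the origin of \<open>coulomb_coeff\<close>; the minus sign is that of (2 i)^2.\<close>

lemma fps_deriv_coulomb_fps:
  "fps_deriv (coulomb_fps L \<eta>) = fps_const (\<i> * (L + 1 - \<i> * \<eta>) / (L + 1)) * coulomb_fps L \<eta> -
     fps_const (coulomb_coeff L \<eta>) * (fps_X * coulomb_fps (L + 1) \<eta>)"
proof -
  let ?a = "L + 1 - \<i> * \<eta>" and ?b = "2 * L + 2"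
  have c1: "2 * \<i> * ?a / ?b = \<i> * ?a / (L + 1)"
  proof -
    have "?b = 2 * (L + 1)" by simp
    thus ?thesis by (simp only: mult.assoc mult_divide_mult_cancel_left_if) simp
  qed
  have c2: "(2 * \<i>)\<^sup>2 * ?a * (?b - ?a) / (?b\<^sup>2 * (?b + 1)) = - coulomb_coeff L \<eta>"
  proof -
    have "(2 * \<i>)\<^sup>2 * ?a * (?b - ?a) = - 4 * ((L + 1)\<^sup>2 + \<eta>\<^sup>2)"
      by (simp add: power2_eq_square algebra_simps)
    moreover have "?b\<^sup>2 * (?b + 1) = 4 * ((L + 1)\<^sup>2 * (2 * L + 3))"
      by (simp add: power2_eq_square algebra_simps)
    ultimately show ?thesis
      using coulomb_nonzero(1,3) by (simp add: coulomb_coeff_def divide_simps)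
  qed
  have arg: "?a + 1 = L + 1 + 1 - \<i> * \<eta>" "?b + 2 = 2 * (L + 1) + 2"
    by (simp_all add: algebra_simps)
  show ?thesis
    using fps_deriv_kummer_fps[OF L, of ?a "2 * \<i>"]
    unfolding c1 c2 arg coulomb_fps_def[symmetric]
    by (simp flip: fps_const_neg)
qed

text \<open>Now (a + 1) (b + 1 - a) = (L + 2)^2 + \<eta>^2, so the last constant contains the
  coefficient c_{L+1} of the derivative formula for L + 1.\<close>

lemma coulomb_fps_three_term:
  "coulomb_fps L \<eta> = coulomb_fps (L + 1) \<eta> +
     fps_const (\<eta> / ((L + 1) * (L + 2))) * (fps_X * coulomb_fps (L + 1) \<eta>) -
     fps_const (coulomb_coeff (L + 1) \<eta> / (2 * L + 3)) * (fps_X * (fps_X * coulomb_fps (L + 1 + 1) \<eta>))"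
proof -
  let ?a = "L + 1 - \<i> * \<eta>" and ?b = "2 * L + 2"
  have c1: "2 * \<i> * (2 * ?a - ?b) / (?b * (?b + 2)) = \<eta> / ((L + 1) * (L + 2))"
  proof -
    have "2 * \<i> * (2 * ?a - ?b) = 4 * \<eta>" "?b * (?b + 2) = 4 * ((L + 1) * (L + 2))"
      by (simp_all add: algebra_simps)
    thus ?thesis by simp
  qed
  have c2: "(2 * \<i>)\<^sup>2 * (?a + 1) * (?b + 1 - ?a) / ((?b + 1) * (?b + 2)\<^sup>2 * (?b + 3)) =
      - (coulomb_coeff (L + 1) \<eta> / (2 * L + 3))"
  proof -
    have "(2 * \<i>)\<^sup>2 * (?a + 1) * (?b + 1 - ?a) = 4 * (- ((L + 2)\<^sup>2 + \<eta>\<^sup>2))"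
      by (simp add: power2_eq_square algebra_simps)
    moreover have "(?b + 1) * (?b + 2)\<^sup>2 * (?b + 3) = 4 * ((2 * L + 3) * (L + 2)\<^sup>2 * (2 * L + 5))"
      by (simp add: power2_eq_square algebra_simps)
    moreover have "coulomb_coeff (L + 1) \<eta> / (2 * L + 3) =
        ((L + 2)\<^sup>2 + \<eta>\<^sup>2) / ((2 * L + 3) * (L + 2)\<^sup>2 * (2 * L + 5))"
    proof -
      have "coulomb_coeff (L + 1) \<eta> = (1 + \<eta>\<^sup>2 / (L + 2)\<^sup>2) / (2 * L + 5)"
        by (simp add: coulomb_coeff_def add.assoc)
      thus ?thesis
        using coulomb_nonzero(2-4) by (simp add: divide_simps)
    qed
    ultimately show ?thesis
      by (simp only: mult_divide_mult_cancel_left_if minus_divide_left) simp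
  qed
  have arg: "?a + 1 = L + 1 + 1 - \<i> * \<eta>" "?b + 2 = 2 * (L + 1) + 2"
    "?a + 2 = L + 1 + 1 + 1 - \<i> * \<eta>" "?b + 4 = 2 * (L + 1 + 1) + 2"
    by (simp_all add: algebra_simps)
  show ?thesis
    using kummer_fps_three_term[OF L, of ?a "2 * \<i>"]
    unfolding c1 c2 unfolding arg coulomb_fps_def[symmetric]
    by (simp flip: fps_const_neg)
qed

lemma coulomb_ratio_J_fraction:
  "coulomb_ratio L \<eta> * (1 + fps_const (\<eta> / ((L + 1) * (L + 2))) * fps_X -
    fps_const (coulomb_coeff (L + 1) \<eta> / (2 * L + 3)) *
      (fps_X * (fps_X * coulomb_ratio (L + 1) \<eta>))) = 1"
proof -
  let ?F = "coulomb_fps L \<eta>" and ?G = "coulomb_fps (L + 1) \<eta>" and ?H = "coulomb_fps (L + 1 + 1) \<eta>"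
  define b a where "b = fps_const (\<eta> / ((L + 1) * (L + 2)))"
    and "a = fps_const (coulomb_coeff (L + 1) \<eta> / (2 * L + 3))"
  have G: "?G * inverse ?G = 1" and F: "?F * inverse ?F = 1"
    by (simp_all add: inverse_mult_eq_1')
  have "coulomb_ratio L \<eta> * (1 + b * fps_X - a * (fps_X * (fps_X * coulomb_ratio (L + 1) \<eta>))) =
      (?G + b * (fps_X * ?G) - (?G * inverse ?G) * (a * (fps_X * (fps_X * ?H)))) * inverse ?F"
    by (simp only: coulomb_ratio_def) (simp add: algebra_simps)
  also have "\<dots> = ?F * inverse ?F"
    by (simp only: G mult_1 coulomb_fps_three_term[of \<eta>, folded a_def b_def, symmetric])
  finally show ?thesis
    by (simp add: F a_def b_def)
qed

section \<open>Zeta values as Taylor coefficients and the resulting determinants\<close>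

lemma coulomb_phi_eq:
  "coulomb_phi L \<eta> \<rho> = exp (- \<i> * \<rho>) * eval_fps (coulomb_fps L \<eta>) \<rho>"
  by (simp add: coulomb_phi_def kummer_1F1_def coulomb_fps_def eval_fps_def kummer_fps_nth
        power_mult_distrib mult_ac)

lemma coulomb_phi_exponential_type: "\<exists>c. exponential_type (coulomb_phi L \<eta>) c"
proof -
  have conv: "fps_conv_radius (coulomb_fps L \<eta>) = \<infinity>"
    unfolding coulomb_fps_def by (rule kummer_fps_exponential_type(1)[OF L])
  obtain K where K: "K > 0" "\<And>z. norm (eval_fps (coulomb_fps L \<eta>) z) \<le> exp (K * norm z)"
    using kummer_fps_exponential_type(2)[OF L] unfolding coulomb_fps_def by blast
  have "exponential_type (coulomb_phi L \<eta>) (1 + K)"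
  proof
    have "(\<lambda>\<rho>. exp (- \<i> * \<rho>) * eval_fps (coulomb_fps L \<eta>) \<rho>) holomorphic_on UNIV"
      by (intro holomorphic_intros) (simp_all add: conv)
    thus "coulomb_phi L \<eta> holomorphic_on UNIV"
      by (simp add: coulomb_phi_eq[abs_def])
    show "coulomb_phi L \<eta> 0 = 1"
      by (simp add: coulomb_phi_eq eval_fps_at_0)
    show "1 + K > 0" using K by simp
    fix z
    have "norm (exp (- \<i> * z)) \<le> exp (norm z)"
      using norm_exp[of "- \<i> * z"] by (simp add: norm_mult)
    hence "norm (coulomb_phi L \<eta> z) \<le> exp (norm z) * exp (K * norm z)"
      unfolding coulomb_phi_eq norm_mult by (intro mult_mono K) auto
    thus "norm (coulomb_phi L \<eta> z) \<le> exp ((1 + K) * norm z)"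
      by (simp add: algebra_simps flip: exp_add)
  qed
  thus ?thesis ..
qed

text \<open>The zeta value at \<open>k + 2\<close> is minus the coefficient of index
  \<open>k + 1\<close> of the logarithmic derivative. The exponential factor and the first term of
  the derivative formula only add constants, invisible at that index; the factor
  \<open>fps_X\<close> lowers it to \<open>k\<close>.\<close>

lemma coulomb_zeta_eq:
  "coulomb_zeta L \<eta> (k + 2) = coulomb_coeff L \<eta> * fps_nth (coulomb_ratio L \<eta>) k"
proof -
  let ?F = "coulomb_fps L \<eta>"
  define \<Phi> where "\<Phi> = fps_exp (- \<i>) * ?F"
  obtain c where "exponential_type (coulomb_phi L \<eta>) c"
    using coulomb_phi_exponential_type by blast
  then interpret exponential_type "coulomb_phi L \<eta>" c .
  have "(\<lambda>\<rho>. exp (- \<i> * \<rho>) * eval_fps ?F \<rho>) has_fps_expansion \<Phi>"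
    unfolding \<Phi>_def
    by (intro fps_expansion_intros eval_fps_has_fps_expansion)
       (simp add: coulomb_fps_def kummer_fps_exponential_type(1)[OF L])
  hence "coulomb_phi L \<eta> has_fps_expansion \<Phi>"
    by (simp add: coulomb_phi_eq[abs_def])
  hence "((\<lambda>\<rho>. of_int (zorder (coulomb_phi L \<eta>) \<rho>) * (1 / \<rho> ^ Suc (Suc k))) has_sum
           - fps_nth (fps_deriv \<Phi> * inverse \<Phi>) (Suc k)) {\<rho>. coulomb_phi L \<eta> \<rho> = 0}"
    by (rule has_sum_zeros) simp
  hence "coulomb_zeta L \<eta> (k + 2) = - fps_nth (fps_deriv \<Phi> * inverse \<Phi>) (Suc k)"
    unfolding coulomb_zeta_def by (simp add: infsumI)
  also have "fps_deriv \<Phi> * inverse \<Phi> =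
      fps_deriv (fps_exp (- \<i>)) * inverse (fps_exp (- \<i>)) + fps_deriv ?F * inverse ?F"
    unfolding \<Phi>_def by (rule fps_log_deriv_mult) auto
  also have "fps_deriv (fps_exp (- \<i>)) * inverse (fps_exp (- \<i>)) = fps_const (- \<i>)"
    by (simp add: mult.assoc inverse_mult_eq_1' del: fps_const_neg)
  also have "fps_deriv ?F * inverse ?F = fps_const (\<i> * (L + 1 - \<i> * \<eta>) / (L + 1)) * (?F * inverse ?F) -
      fps_const (coulomb_coeff L \<eta>) * (fps_X * coulomb_ratio L \<eta>)"
    unfolding fps_deriv_coulomb_fps coulomb_ratio_def by (simp only: ring_distribs mult.assoc)
  also have "?F * inverse ?F = 1"
    by (simp add: inverse_mult_eq_1')
  finally show ?thesis by simp
qed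

lemma det_coulomb_hankel_eq:
  "Determinant.det (coulomb_hankel n L \<eta>) =
     coulomb_coeff L \<eta> ^ n * Determinant.det (hankel_mat n (coulomb_ratio L \<eta>))"
proof -
  have "coulomb_hankel n L \<eta> = coulomb_coeff L \<eta> \<cdot>\<^sub>m hankel_mat n (coulomb_ratio L \<eta>)"
    using coulomb_zeta_eq by (intro eq_matI) (auto simp: coulomb_hankel_def hankel_mat_def)
  thus ?thesis
    by (simp add: hankel_mat_def)
qed

end

text \<open>Each base on the right depends on L and n only through L + n, which is unchanged when (n
  + 1, L) becomes (n, L + 1). The factors with \<open>k < n\<close> are thus literally those of the
  induction hypothesis, and the new one is \<open>k = n\<close>.\<close>

lemma det_coulomb_hankel_prod:
  assumes "\<And>m. 2 * L + 2 + of_nat m \<noteq> 0"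
  shows "Determinant.det (coulomb_hankel n L \<eta>) =
    (\<Prod>k<n. 1 / (2 * L + 2 * of_nat n - 2 * of_nat k + 1) ^ (2 * k + 1) *
       (1 + \<eta>\<^sup>2 / (L + of_nat n - of_nat k)\<^sup>2) ^ (k + 1))"
  using assms
proof (induction n arbitrary: L)
  case 0
  show ?case by (simp add: coulomb_hankel_def)
next
  case (Suc n)
  have L1: "2 * (L + 1) + 2 + of_nat m \<noteq> 0" for m
    using Suc.prems[of "m + 2"] by (simp add: algebra_simps)
  let ?D = "\<lambda>n L. Determinant.det (hankel_mat n (coulomb_ratio L \<eta>))"
  have "Determinant.det (coulomb_hankel (Suc n) L \<eta>) =
      coulomb_coeff L \<eta> ^ Suc n * (coulomb_coeff (L + 1) \<eta> / (2 * L + 3)) ^ n * ?D n (L + 1)"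
    unfolding det_coulomb_hankel_eq[OF Suc.prems]
      det_hankel_J_fraction[OF coulomb_ratio_J_fraction[OF Suc.prems]] by simp
  also have "\<dots> = coulomb_coeff L \<eta> ^ Suc n / (2 * L + 3) ^ n * Determinant.det (coulomb_hankel n (L + 1) \<eta>)"
    unfolding det_coulomb_hankel_eq[OF L1] by (simp add: power_divide)
  also have "coulomb_coeff L \<eta> ^ Suc n / (2 * L + 3) ^ n =
      1 / (2 * L + 3) ^ (2 * n + 1) * (1 + \<eta>\<^sup>2 / (L + 1)\<^sup>2) ^ (n + 1)"
  proof -
    have "(x / y) ^ Suc n / y ^ n = 1 / y ^ (2 * n + 1) * x ^ (n + 1)" for x y :: complex
    proof -
      have "y ^ (2 * n + 1) = y ^ Suc n * y ^ n"
        by (simp add: mult_2 power_add)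
      thus ?thesis
        by (simp add: power_divide del: power_Suc)
    qed
    thus ?thesis
      unfolding coulomb_coeff_def .
  qed
  also have "Determinant.det (coulomb_hankel n (L + 1) \<eta>) =
    (\<Prod>k<n. 1 / (2 * L + 2 * of_nat (Suc n) - 2 * of_nat k + 1) ^ (2 * k + 1) *
       (1 + \<eta>\<^sup>2 / (L + of_nat (Suc n) - of_nat k)\<^sup>2) ^ (k + 1))"
  proof -
    have "2 * (L + 1) + 2 * of_nat n = 2 * L + 2 * of_nat (Suc n)"
      "L + 1 + of_nat n = L + of_nat (Suc n)"
      by simp_all
    thus ?thesis
      by (simp only: Suc.IH[OF L1])
  qed
  finally have IH: "Determinant.det (coulomb_hankel (Suc n) L \<eta>) =
      1 / (2 * L + 3) ^ (2 * n + 1) * (1 + \<eta>\<^sup>2 / (L + 1)\<^sup>2) ^ (n + 1) *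
      (\<Prod>k<n. 1 / (2 * L + 2 * of_nat (Suc n) - 2 * of_nat k + 1) ^ (2 * k + 1) *
         (1 + \<eta>\<^sup>2 / (L + of_nat (Suc n) - of_nat k)\<^sup>2) ^ (k + 1))" .
  have last: "2 * L + 2 * of_nat (Suc n) - 2 * of_nat n + 1 = 2 * L + 3"
    "L + of_nat (Suc n) - of_nat n = L + 1"
    by simp_all
  show ?case
    by (simp only: IH prod.lessThan_Suc last) (rule mult.commute)
qed

theorem theorem1:
  fixes L \<eta> :: complex and n :: nat
  assumes "L \<notin> {- (of_nat m + 1) / 2 | m :: nat. m \<ge> 1}"
    and "n \<ge> 1"
  shows "Determinant.det (coulomb_hankel n L \<eta>) =
    (\<Prod>k = 0..n - 1.
       1 / (2 * L + 2 * of_nat n - 2 * of_nat k + 1) ^ (2 * k + 1) *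
       (1 + \<eta>\<^sup>2 / (L + of_nat n - of_nat k)\<^sup>2) ^ (k + 1))"
proof -
  have nz: "2 * L + 2 + of_nat m \<noteq> 0" for m
  proof
    assume eq: "2 * L + 2 + of_nat m = 0"
    \<comment> \<open>The excluded values -(m + 1) / 2 start at m = 1, whereas the lower Kummer
      parameter is shifted from m = 0 on; hence the witness \<open>Suc m\<close>.\<close>
    have "L = ((2 * L + 2 + of_nat m) - (of_nat (Suc m) + 1)) / 2"
      by simp
    also have "\<dots> = - (of_nat (Suc m) + 1) / 2"
      by (simp only: eq diff_0)
    finally have "L \<in> {- (of_nat m + 1) / 2 | m :: nat. m \<ge> 1}"
      by (intro CollectI exI[of _ "Suc m"] conjI) simp_all
    with assms(1) show False
      by (rule notE)
  qed
  \<comment> \<open>Natural subtraction truncates: for \<open>n = 0\<close> the interval would still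
    contain 0.\<close>
  have "{0..n - 1} = {..<n}"
    using assms(2) by (cases n) (auto simp: less_Suc_eq_le)
  thus ?thesis
    using det_coulomb_hankel_prod[of L n \<eta>, OF nz] by (simp only:)
qed

end
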